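(* There is an instance of the stochastic ball model (SBM) with $m=2$, $k=7$, $\min_{i\ne j}d(c_i,c_j)=2+0.2$, where $\mu$ has a continuous density function and the probability space $(\mu,B^2_1(0))$ satisfies (a1) and (a2), such that with high probability (LP) does not achieve exact recovery.
   Context: Notation: $d$ is the Euclidean distance, $B^m_r(c)$ the closed ball of radius $r>0$ and center $c$ in $\mathbb{R}^m$, $[k]=\{1,\dots,k\}$. SBM (with ball centers $c_1,\dots,c_k\in\mathbb{R}^m$): $(\mu,B^m_1(0))$ is a probability space (i.e. $\mu$ is a Borel probability measure on the closed unit ball). For each $i\in[k]$ one draws $n$ i.i.d. random vectors $v^{(i)}_\ell$, $\ell\in[n]$, according to $\mu$ (draws for different $i$ being independent), and the points from cluster $i$ are $x^{(i)}_\ell:=c_i+v^{(i)}_\ell$, $\ell\in[n]$; these are said to be drawn from the ball $B^m_1(c_i)$. An instance is a choice of $m$, $k$, $c_1,\dots,c_k$ and $\mu$. Assumptions: (a1) $\mu$ is invariant under rotations centered in $0$; (a2) every open subset of $B^m_1(0)$ containing $0$ has positive probability measure. With $P$ the set of all sampled points, (LP) is \[ \min \sum_{p,q\in P} d(p,q)z_{pq}\ \text{ s.t. }\ \sum_{p\in P}z_{pq}=1\ \forall q\in P;\ z_{pq}\le y_p\ \forall p,q\in P;\ \sum_{p\in P}y_p=k;\ y_p,z_{pq}\ge0\ \forall p,q\in P, \] and (IP) is the same program with $y_p,z_{pq}\in\{0,1\}$. (LP) achieves exact recovery if it has a unique optimal solution, this solution is also feasible (thus optimal) to (IP), and it assigns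 each point to the ball from which it is drawn (exactly one point drawn from each ball has $y_p=1$, and $z_{pq}=1$ only if $p,q$ are drawn from the same ball). An event $A_n$ depending on the parameter $n$ happens with high probability if for every $\delta\in(0,1)$ there exists $N>0$ such that $\mathbb{P}(A_n)>1-\delta$ whenever $n>N$. *)

theory Defs
  imports "HOL-Probability.Probability"
begin

definition unit_ball_distribution :: "(real ^ 'm) measure \<Rightarrow> bool" where
  "unit_ball_distribution mu \<longleftrightarrow>
     prob_space mu \<and> sets mu = sets (restrict_space borel (cball 0 1))"

definition rotation_invariant :: "(real ^ 'm) measure \<Rightarrow> bool" where
  "rotation_invariant mu \<longleftrightarrow>
     (\<forall>Q :: real ^ 'm ^ 'm. rotation_matrix Q \<longrightarrow> distr mu mu (\<lambda>v. Q *v v) = mu)"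

definition charges_nbhds_of_0 :: "(real ^ 'm) measure \<Rightarrow> bool" where
  "charges_nbhds_of_0 mu \<longleftrightarrow>
     (\<forall>U. openin (top_of_set (cball 0 1)) U \<and> 0 \<in> U \<longrightarrow> measure mu U > 0)"

text \<open>The density is taken with respect to Lebesgue measure on the closed unit ball, the space
  on which the distribution lives; it is continuous there and need not vanish on the boundary.\<close>

definition has_continuous_density :: "(real ^ 'm) measure \<Rightarrow> bool" where
  "has_continuous_density mu \<longleftrightarrow>
     (\<exists>f :: real ^ 'm \<Rightarrow> real. continuous_on (cball 0 1) f \<and> (\<forall>x\<in>cball 0 1. 0 \<le> f x) \<and>
        mu = density (restrict_space lborel (cball 0 1)) (\<lambda>x. ennreal (f x)))"

text \<open>An outcome \<open>\<omega>\<close> of the stochastic ball model assigns to \<open>(i, l)\<close> the random vector that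
  is added to the centre \<open>c i\<close> to give the \<open>l\<close>-th point of cluster \<open>i\<close>.\<close>

definition sbm_space :: "(real ^ 'm) measure \<Rightarrow> nat \<Rightarrow> nat \<Rightarrow> (nat \<times> nat \<Rightarrow> real ^ 'm) measure" where
  "sbm_space mu k n = (\<Pi>\<^sub>M il\<in>{1..k} \<times> {1..n}. mu)"

definition sbm_cluster ::
  "(nat \<Rightarrow> real ^ 'm) \<Rightarrow> nat \<Rightarrow> (nat \<times> nat \<Rightarrow> real ^ 'm) \<Rightarrow> nat \<Rightarrow> (real ^ 'm) set" where
  "sbm_cluster c n \<omega> i = (\<lambda>l. c i + \<omega> (i, l)) ` {1..n}"

definition lp_feasible ::
  "'a set \<Rightarrow> nat \<Rightarrow> ('a \<Rightarrow> real) \<Rightarrow> ('a \<Rightarrow> 'a \<Rightarrow> real) \<Rightarrow> bool" where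
  "lp_feasible P k y z \<longleftrightarrow>
     (\<forall>q\<in>P. (\<Sum>p\<in>P. z p q) = 1) \<and>
     (\<forall>p\<in>P. \<forall>q\<in>P. z p q \<le> y p) \<and>
     (\<Sum>p\<in>P. y p) = real k \<and>
     (\<forall>p\<in>P. 0 \<le> y p) \<and> (\<forall>p\<in>P. \<forall>q\<in>P. 0 \<le> z p q)"

definition ip_feasible ::
  "'a set \<Rightarrow> nat \<Rightarrow> ('a \<Rightarrow> real) \<Rightarrow> ('a \<Rightarrow> 'a \<Rightarrow> real) \<Rightarrow> bool" where
  "ip_feasible P k y z \<longleftrightarrow>
     (\<forall>q\<in>P. (\<Sum>p\<in>P. z p q) = 1) \<and>
     (\<forall>p\<in>P. \<forall>q\<in>P. z p q \<le> y p) \<and>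
     (\<Sum>p\<in>P. y p) = real k \<and>
     (\<forall>p\<in>P. y p \<in> {0, 1}) \<and> (\<forall>p\<in>P. \<forall>q\<in>P. z p q \<in> {0, 1})"

definition lp_cost :: "'a::metric_space set \<Rightarrow> ('a \<Rightarrow> 'a \<Rightarrow> real) \<Rightarrow> real" where
  "lp_cost P z = (\<Sum>p\<in>P. \<Sum>q\<in>P. dist p q * z p q)"

definition lp_optimal ::
  "'a::metric_space set \<Rightarrow> nat \<Rightarrow> ('a \<Rightarrow> real) \<Rightarrow> ('a \<Rightarrow> 'a \<Rightarrow> real) \<Rightarrow> bool" where
  "lp_optimal P k y z \<longleftrightarrow>
     lp_feasible P k y z \<and> (\<forall>y' z'. lp_feasible P k y' z' \<longrightarrow> lp_cost P z \<le> lp_cost P z')"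

text \<open>Solutions are total functions of which only the values on \<open>P\<close> matter, so uniqueness
  means agreement on \<open>P\<close>.\<close>

definition lp_unique_optimal ::
  "'a::metric_space set \<Rightarrow> nat \<Rightarrow> ('a \<Rightarrow> real) \<Rightarrow> ('a \<Rightarrow> 'a \<Rightarrow> real) \<Rightarrow> bool" where
  "lp_unique_optimal P k y z \<longleftrightarrow>
     lp_optimal P k y z \<and>
     (\<forall>y' z'. lp_optimal P k y' z' \<longrightarrow>
        (\<forall>p\<in>P. y' p = y p) \<and> (\<forall>p\<in>P. \<forall>q\<in>P. z' p q = z p q))"

text \<open>\<open>C i\<close>, for \<open>1 \<le> i \<le> k\<close>, is the set of points drawn from the \<open>i\<close>-th ball.\<close>

definition exact_recovery :: "nat \<Rightarrow> (nat \<Rightarrow> 'a::metric_space set) \<Rightarrow> bool" where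
  "exact_recovery k C \<longleftrightarrow>
     (let P = (\<Union>i\<in>{1..k}. C i) in
      \<exists>y z. lp_unique_optimal P k y z \<and> ip_feasible P k y z \<and>
        (\<forall>i\<in>{1..k}. \<exists>!p. p \<in> C i \<and> y p = 1) \<and>
        (\<forall>p\<in>P. \<forall>q\<in>P. z p q = 1 \<longrightarrow> (\<exists>i\<in>{1..k}. p \<in> C i \<and> q \<in> C i)))"

definition with_high_probability :: "(nat \<Rightarrow> 'w measure) \<Rightarrow> (nat \<Rightarrow> 'w \<Rightarrow> bool) \<Rightarrow> bool" where
  "with_high_probability M A \<longleftrightarrow>
     (\<forall>\<delta>::real. 0 < \<delta> \<and> \<delta> < 1 \<longrightarrow>
        (\<exists>N>0. \<forall>n>N. measure (M n) {\<omega> \<in> space (M n). A n \<omega>} > 1 - \<delta>))"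

end

(* Put the seven centres on a line at distance 2.2 and let mu live almost entirely near the unit
   circle (density proportional to |v|^K with K large).  An integral solution that recovers the
   clusters costs about 1 per point.  A half-integral solution does better: open two half
   facilities in each ball, at the two contact points with the neighbouring balls (in the first and
   last ball: at the only contact point and at the centre).  A point v of an interior ball with
   v1 >= 0 is served by the own contact point e1 and by that of the neighbour, at 1.2 e1; by
   elementary inequalities this costs at most 1.5 - 1.225 v1^2.  As rotation invariance gives
   E v1^2 = E |v|^2 / 2, this is less than 0.89 on average, which outweighs the loss in the two
   extreme balls.  The empirical moments needed are controlled by Hoeffding's inequality.

   Exact recovery has to be shown to be a measurable event.  Strict optimality over the uncountable
   set of feasible solutions is reduced to countably many conditions: the feasible solutions at
   distance at least 1/(m+1) form a compact set, on which positivity of the cost gap is detected by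
   a countable dense subset.  Coinciding sample points are handled by choosing representatives. *)
theory Submission
  imports Defs
begin

section \<open>Linear programs and exact recovery\<close>

text \<open>Why seven balls: with the mass close to the circle, an interior ball costs about 1.5 -
  1.225/2 = 0.8875 per point and saves about 0.11, while an extreme ball costs about (1 + sqrt 2)/2
  = 1.207 and loses about 0.21. Four interior balls would save only slightly more than the extreme
  ones lose, a surplus that the error terms used here eat up; five leave room. The medoids of an
  integral solution depend on the sample, so the lower bound must hold for all centres at once. The
  inequality |v - m| >= |v|^2 - <m, v> is affine in m, hence coordinate sums control every m in the
  unit ball simultaneously. The upper bounds are polynomials of degree at most two in v1. So
  finitely many averages suffice: coordinates, their squares, and the frequencies of hitting small
  discs around the facility positions. Measurability matters because \<open>measure\<close> gives 0
  to a set outside the sigma-algebra: a likely event inside the failure event proves nothing until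
  the latter is measurable. Distinctness of the sample points matters because clusters are sets: a
  coincidence would drop a summand.\<close>

lemma half_integral_feasible:
  fixes P :: "'a::metric_space set"
  assumes "finite P" "S \<subseteq> P" "card S = 2 * k"
    and FG: "\<And>q. q \<in> P \<Longrightarrow> F q \<in> S \<and> G q \<in> S \<and> F q \<noteq> G q"
  defines "z \<equiv> \<lambda>p q. if p \<in> {F q, G q} then 1/2 else 0"
  shows "lp_feasible P k (\<lambda>p. if p \<in> S then 1/2 else 0) z"
    and "lp_cost P z = (\<Sum>q\<in>P. (dist (F q) q + dist (G q) q) / 2)"
proof -
  \<comment> \<open>Column \<open>q\<close> of \<open>z\<close> lives on the two distinct facilities
    \<open>F q\<close> and \<open>G q\<close>, so a weighted column sum has two terms. Weight 1
    gives feasibility, weight \<open>dist p q\<close> gives the cost.\<close>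
  have sum_z: "(\<Sum>p\<in>P. f p * z p q) = (f (F q) + f (G q)) / 2" if "q \<in> P" for f q
  proof -
    have "(\<Sum>p\<in>P. f p * z p q) = (\<Sum>p\<in>{F q, G q}. f p * z p q)"
      using FG[OF that] assms(1,2) by (intro sum.mono_neutral_right) (auto simp: z_def)
    then show ?thesis
      using FG[OF that] by (simp add: z_def add_divide_distrib)
  qed
  have "(\<Sum>p\<in>P. if p \<in> S then 1/2 else 0 :: real) = (\<Sum>p\<in>S. 1/2)"
    using assms(1,2) by (simp add: sum.If_cases Int_absorb1)
  then show "lp_feasible P k (\<lambda>p. if p \<in> S then 1/2 else 0) z"
    using sum_z[of _ "\<lambda>_. 1"] FG assms(3) by (auto simp: lp_feasible_def z_def)
  have "lp_cost P z = (\<Sum>q\<in>P. \<Sum>p\<in>P. dist p q * z p q)"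
    unfolding lp_cost_def by (rule sum.swap)
  also have "\<dots> = (\<Sum>q\<in>P. (dist (F q) q + dist (G q) q) / 2)"
    using sum_z by (intro sum.cong) auto
  finally show "lp_cost P z = (\<Sum>q\<in>P. (dist (F q) q + dist (G q) q) / 2)" .
qed

text \<open>A 0/1 column with sum 1 has an entry 1; its facility is open because
  \<open>z p q \<le> y p\<close>, and lies in the ball of \<open>q\<close> by the recovery condition
  and disjointness. The only open point there is the medoid. Comparing with an arbitrary feasible
  solution, rather than with an optimal one, lets a half-integral competitor be inserted
  later.\<close>

lemma exact_recovery_medoids:
  fixes C :: "nat \<Rightarrow> 'a::metric_space set"
  assumes rec: "exact_recovery k C"
    and fin: "\<And>i. i \<in> {1..k} \<Longrightarrow> finite (C i)"
    and disj: "disjoint_family_on C {1..k}"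
  obtains m where "\<And>i. i \<in> {1..k} \<Longrightarrow> m i \<in> C i"
    and "\<And>y z. lp_feasible (\<Union>i\<in>{1..k}. C i) k y z \<Longrightarrow>
          (\<Sum>i\<in>{1..k}. \<Sum>q\<in>C i. dist (m i) q) \<le> lp_cost (\<Union>i\<in>{1..k}. C i) z"
proof -
  define P where "P = (\<Union>i\<in>{1..k}. C i)"
  have finP: "finite P" using fin by (auto simp: P_def)
  obtain y z where opt: "lp_unique_optimal P k y z" and ip: "ip_feasible P k y z"
    and one: "\<forall>i\<in>{1..k}. \<exists>!p. p \<in> C i \<and> y p = 1"
    and own: "\<forall>p\<in>P. \<forall>q\<in>P. z p q = 1 \<longrightarrow> (\<exists>i\<in>{1..k}. p \<in> C i \<and> q \<in> C i)"
    using rec[unfolded exact_recovery_def Let_def, folded P_def]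
    by (elim exE conjE) (rule that; assumption)
  define m where "m i = (THE p. p \<in> C i \<and> y p = 1)" for i
  have m: "m i \<in> C i \<and> y (m i) = 1" if "i \<in> {1..k}" for i
    unfolding m_def using theI'[of "\<lambda>p. p \<in> C i \<and> y p = 1"] one that by blast
  have m_unique: "p = m i" if "i \<in> {1..k}" "p \<in> C i" "y p = 1" for i p
    using one m that by blast
  have z_nn: "z p q \<ge> 0" if "p \<in> P" "q \<in> P" for p q
  proof -
    have "z p q \<in> {0, 1}" using ip that unfolding ip_feasible_def by blast
    then show ?thesis by auto
  qed
  have assigned: "z (m i) q = 1" if i: "i \<in> {1..k}" and q: "q \<in> C i" for i q
  proof -
    have qP: "q \<in> P" using i q by (auto simp: P_def)
    have "(\<Sum>p\<in>P. z p q) = 1" using ip qP by (simp add: ip_feasible_def)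
    then obtain p where p: "p \<in> P" "z p q \<noteq> 0"
      by (metis sum.neutral zero_neq_one)
    have "z p q \<in> {0, 1}" "z p q \<le> y p" "y p \<in> {0, 1}"
      using ip p(1) qP unfolding ip_feasible_def by blast+
    with p(2) have z1: "z p q = 1" and "y p = 1" by auto
    obtain j where j: "j \<in> {1..k}" "p \<in> C j" "q \<in> C j"
      using own p(1) qP z1 by blast
    then have "j = i"
      using disj i q unfolding disjoint_family_on_def by blast
    with m_unique[OF j(1,2) \<open>y p = 1\<close>] z1 show ?thesis by simp
  qed
  have "(\<Sum>i\<in>{1..k}. \<Sum>q\<in>C i. dist (m i) q) \<le> lp_cost P z"
  proof -
    have "(\<Sum>i\<in>{1..k}. \<Sum>q\<in>C i. dist (m i) q)
        \<le> (\<Sum>i\<in>{1..k}. \<Sum>q\<in>C i. \<Sum>p\<in>P. dist p q * z p q)"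
    proof (intro sum_mono)
      fix i q assume i: "i \<in> {1..k}" and q: "q \<in> C i"
      then have "m i \<in> P" "q \<in> P" using m[OF i] unfolding P_def by blast+
      then have "dist (m i) q * z (m i) q \<le> (\<Sum>p\<in>P. dist p q * z p q)"
        using z_nn finP by (intro member_le_sum) auto
      then show "dist (m i) q \<le> (\<Sum>p\<in>P. dist p q * z p q)"
        using assigned[OF i q] by simp
    qed
    also have "\<dots> = (\<Sum>q\<in>P. \<Sum>p\<in>P. dist p q * z p q)"
      unfolding P_def using fin disj
      by (intro sum.UNION_disjoint[symmetric]) (auto simp: disjoint_family_on_def)
    also have "\<dots> = lp_cost P z"
      unfolding lp_cost_def by (rule sum.swap)
    finally show ?thesis .
  qed
  moreover have "lp_cost P z \<le> lp_cost P z'" if "lp_feasible P k y' z'" for y' z'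
    using opt that by (auto simp: lp_unique_optimal_def lp_optimal_def)
  ultimately have "(\<Sum>i\<in>{1..k}. \<Sum>q\<in>C i. dist (m i) q) \<le> lp_cost P z'" if "lp_feasible P k y' z'" for y' z'
    using that by (meson order_trans)
  then show thesis
    using that[of m] m unfolding P_def by blast
qed

section \<open>Planar estimates for the distances to the contact points\<close>

lemma near_contact_bound:
  fixes s :: real
  assumes "0 \<le> s" "s \<le> 1"
  shows "2 - 2 * s \<le> (1.43 - 1.2 * s\<^sup>2)\<^sup>2"
proof -
  \<comment> \<open>The difference is smallest near \<open>s = 0.89\<close>, where it is almost a double zero.\<close>
  have "(1.43 - 1.2 * s\<^sup>2)\<^sup>2 - (2 - 2 * s)
      = (s - 0.89)\<^sup>2 * s * (1.44 * s + 2.5632) + (0.0449 - 0.03031072 * s - 0.010128 * s\<^sup>2)"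
    by (simp add: power2_eq_square field_simps)
  moreover have "s\<^sup>2 \<le> 1" using assms by (simp add: power_le_one)
  then have "0.0449 - 0.03031072 * s - 0.010128 * s\<^sup>2 \<ge> 0" using assms by simp
  moreover have "(s - 0.89)\<^sup>2 * s * (1.44 * s + 2.5632) \<ge> 0" using assms by simp
  ultimately show ?thesis by linarith
qed

lemma far_contact_bound:
  fixes s :: real
  assumes "0 \<le> s" "s \<le> 1"
  shows "2.44 - 2.4 * s \<le> (1.57 - 1.25 * s\<^sup>2)\<^sup>2"
proof -
  \<comment> \<open>The same pattern with the square centred at 0.9: the coefficient 2.8125 = 1.8 *
    1.5625 cancels the cubic term, and the remainder is nonnegative because
    \<open>s\<^sup>2 \<le> s\<close>.\<close>
  have "(1.57 - 1.25 * s\<^sup>2)\<^sup>2 - (2.44 - 2.4 * s)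
      = (s - 0.9)\<^sup>2 * s * (1.5625 * s + 2.8125) + 0.128125 * (s - s\<^sup>2) + (0.0249 - 0.00625 * s)"
    by (simp add: power2_eq_square field_simps)
  moreover have "s\<^sup>2 \<le> s" using assms by (simp add: power2_eq_square mult_left_le)
  then have "0.128125 * (s - s\<^sup>2) \<ge> 0" "0.0249 - 0.00625 * s \<ge> 0" using assms by simp_all
  moreover have "(s - 0.9)\<^sup>2 * s * (1.5625 * s + 2.8125) \<ge> 0" using assms by simp
  ultimately show ?thesis by linarith
qed

abbreviation e1 :: "real ^ 2" where "e1 \<equiv> axis 1 1"

lemma norm_vec2_sq: "(norm (v :: real ^ 2))\<^sup>2 = (v $ 1)\<^sup>2 + (v $ 2)\<^sup>2"
  by (simp add: norm_vec_def L2_set_def sum_2)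

lemma norm_diff_axis_sq:
  fixes v :: "real ^ 2"
  assumes "norm v \<le> 1"
  shows "(norm (v - t *\<^sub>R e1))\<^sup>2 \<le> 1 + t\<^sup>2 - 2 * t * v $ 1"
proof -
  have "(norm v)\<^sup>2 \<le> 1" using assms by (simp add: power_le_one)
  then show ?thesis
    unfolding norm_vec2_sq by (simp add: axis_def power2_eq_square algebra_simps)
qed

text \<open>With s = v1, the distances are at most sqrt (2 - 2 s) and sqrt (2.44 - 2.4 s), and each
  root is majorised by a constant minus a multiple of s^2. A quadratic majorant is chosen because
  the other half of the ball is treated by reflection: a linear one would involve the mean of |v1|,
  whereas the mean of v1^2 follows from rotation invariance and the mean of |v|^2.\<close>

lemma norm_contacts_le:
  fixes v :: "real ^ 2"
  assumes "norm v \<le> 1" "0 \<le> v $ 1"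
  shows "norm (v - e1) + norm (v - 1.2 *\<^sub>R e1) \<le> 3 - 2.45 * (v $ 1)\<^sup>2"
proof -
  have s: "v $ 1 \<le> 1" using assms component_le_norm_cart[of v 1] by linarith
  then have s2: "(v $ 1)\<^sup>2 \<le> 1" using assms(2) by (simp add: power_le_one)
  have "(norm (v - e1))\<^sup>2 \<le> 2 - 2 * v $ 1"
    using norm_diff_axis_sq[OF assms(1), of 1] by simp
  also note near_contact_bound[OF assms(2) s]
  finally have "norm (v - e1) \<le> 1.43 - 1.2 * (v $ 1)\<^sup>2"
    by (rule power2_le_imp_le) (use s2 in simp)
  moreover have "(norm (v - 1.2 *\<^sub>R e1))\<^sup>2 \<le> 2.44 - 2.4 * v $ 1"
    using norm_diff_axis_sq[OF assms(1), of "1.2"] by (simp add: power2_eq_square)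
  then have "(norm (v - 1.2 *\<^sub>R e1))\<^sup>2 \<le> (1.57 - 1.25 * (v $ 1)\<^sup>2)\<^sup>2"
    using far_contact_bound[OF assms(2) s] by (rule order_trans)
  then have "norm (v - 1.2 *\<^sub>R e1) \<le> 1.57 - 1.25 * (v $ 1)\<^sup>2"
    by (rule power2_le_imp_le) (use s2 in simp)
  ultimately show ?thesis by (simp add: field_simps)
qed

text \<open>Meant for the extreme balls, where points of both signs of v1 use the same contact
  point. As v1 has mean zero, a linear bound averages to its constant term 3.96 / 2.8, which is just
  above sqrt 2.\<close>

lemma norm_contact_le_linear:
  fixes v :: "real ^ 2"
  assumes "norm v \<le> 1"
  shows "norm (v - e1) \<le> (3.96 - 2 * v $ 1) / 2.8"
proof -
  have "(norm (v - e1))\<^sup>2 \<le> 2 - 2 * v $ 1"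
    using norm_diff_axis_sq[OF assms, of 1] by simp
  \<comment> \<open>AM-GM, with 1.4 in the place of the square root of 2\<close>
  moreover have "(norm (v - e1) - 1.4)\<^sup>2 \<ge> 0" by simp
  ultimately show ?thesis by (simp add: power2_eq_square algebra_simps)
qed

lemma norm_diff_ge_inner:
  fixes v m :: "'a::real_inner"
  assumes "norm v \<le> 1"
  shows "norm (v - m) \<ge> (norm v)\<^sup>2 - m \<bullet> v"
proof -
  have "(norm v)\<^sup>2 - m \<bullet> v = (v - m) \<bullet> v"
    by (simp add: inner_diff_left power2_norm_eq_inner)
  also have "\<dots> \<le> norm (v - m) * norm v" by (rule norm_cauchy_schwarz)
  also have "\<dots> \<le> norm (v - m)" using assms by (simp add: mult_left_le)
  finally show ?thesis .
qed

section \<open>The configuration on a line and its half-integral competitor\<close>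

definition line_center :: "nat \<Rightarrow> real ^ 2" where
  "line_center i = (2.2 * real i) *\<^sub>R e1"

lemma line_center_diff: "line_center i - line_center j = (2.2 * (real i - real j)) *\<^sub>R e1"
  by (simp add: line_center_def scaleR_diff_left right_diff_distrib)

lemma dist_line_center: "dist (line_center i) (line_center j) = 2.2 * \<bar>real i - real j\<bar>"
  unfolding dist_norm line_center_diff norm_scaleR abs_mult by simp

lemma line_center_separated:
  assumes "norm u \<le> 1" "norm v \<le> 1" "line_center i + u = line_center j + v"
  shows "i = j"
proof (rule ccontr)
  assume "i \<noteq> j"
  then have "\<bar>real i - real j\<bar> \<ge> 1" by linarith
  then have "dist (line_center i) (line_center j) \<ge> 2.2"
    unfolding dist_line_center by simp
  moreover have "line_center i - line_center j = v - u"
    using assms(3) by (simp add: algebra_simps)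
  then have "dist (line_center i) (line_center j) \<le> norm v + norm u"
    unfolding dist_norm by (metis norm_triangle_ineq4)
  ultimately show False using assms(1,2) by simp
qed

lemma disjoint_line_clusters:
  assumes "\<And>i l. i \<in> {1..k} \<Longrightarrow> l \<in> {1..n} \<Longrightarrow> norm (\<omega> (i, l)) \<le> 1"
  shows "disjoint_family_on (sbm_cluster line_center n \<omega>) {1..k}"
  unfolding disjoint_family_on_def sbm_cluster_def using line_center_separated assms by blast

text \<open>The right-hand side is free of \<open>m\<close>: the coordinates of \<open>m\<close> are
  at most 1 in absolute value, so the linear term is absorbed by the absolute coordinate sums. Hence
  \<open>m\<close> may be one of the sample points, chosen with knowledge of all of them.\<close>

lemma sum_norm_diff_ge:
  fixes v :: "nat \<Rightarrow> real ^ 2"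
  assumes v: "\<And>l. l \<in> {1..n} \<Longrightarrow> norm (v l) \<le> 1" and "norm m \<le> 1"
  shows "(\<Sum>l\<in>{1..n}. norm (v l - m))
    \<ge> (\<Sum>l\<in>{1..n}. (v l $ 1)\<^sup>2) + (\<Sum>l\<in>{1..n}. (v l $ 2)\<^sup>2)
       - \<bar>\<Sum>l\<in>{1..n}. v l $ 1\<bar> - \<bar>\<Sum>l\<in>{1..n}. v l $ 2\<bar>"
proof -
  have m: "\<bar>m $ j\<bar> \<le> 1" for j
    using component_le_norm_cart[of m j] assms(2) by linarith
  have mult_le: "m $ j * s \<le> \<bar>s\<bar>" for j s
  proof -
    have "m $ j * s \<le> \<bar>m $ j\<bar> * \<bar>s\<bar>" by (metis abs_ge_self abs_mult)
    also have "\<dots> \<le> \<bar>s\<bar>" using m[of j] by (simp add: mult_left_le_one_le)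
    finally show ?thesis .
  qed
  have "(\<Sum>l\<in>{1..n}. norm (v l - m))
      \<ge> (\<Sum>l\<in>{1..n}. (v l $ 1)\<^sup>2 + (v l $ 2)\<^sup>2 - (m $ 1 * v l $ 1 + m $ 2 * v l $ 2))"
    using norm_diff_ge_inner[OF v, of _ m]
    by (intro sum_mono) (simp add: norm_vec2_sq inner_vec_def sum_2)
  then show ?thesis
    using mult_le[of 1 "\<Sum>l\<in>{1..n}. v l $ 1"] mult_le[of 2 "\<Sum>l\<in>{1..n}. v l $ 2"]
    by (simp add: sum.distrib sum_subtractf sum_distrib_left)
qed

lemma dist_shifted_facility:
  assumes "norm (w - t *\<^sub>R e1) \<le> \<epsilon>"
  shows "dist (line_center i + w) (line_center j + v)
    \<le> norm (v - (2.2 * (real i - real j) + t) *\<^sub>R e1) + \<epsilon>"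
proof -
  have "(line_center i + w) - (line_center j + v)
      = (w - t *\<^sub>R e1) - (v - (2.2 * (real i - real j) + t) *\<^sub>R e1)"
    using line_center_diff[of i j] by (simp add: algebra_simps)
  then have "dist (line_center i + w) (line_center j + v)
      \<le> norm (w - t *\<^sub>R e1) + norm (v - (2.2 * (real i - real j) + t) *\<^sub>R e1)"
    unfolding dist_norm by (metis norm_triangle_ineq4)
  with assms show ?thesis by linarith
qed

text \<open>The deterministic core. Randomness enters only through the hit condition
  \<open>near\<close> and the moment conditions \<open>first\<close> and \<open>second\<close>, all
  with tolerance 1/1000, small enough for the numerical margin left when
  \<open>m2 \<ge> 0.999\<close>.\<close>

lemma line_not_exact_recovery:
  fixes \<omega> :: "nat \<times> nat \<Rightarrow> real ^ 2" and m2 :: real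
  assumes n: "n > 0"
    and unit: "\<And>i l. i \<in> {1..7} \<Longrightarrow> l \<in> {1..n} \<Longrightarrow> norm (\<omega> (i, l)) \<le> 1"
    and inj: "inj_on (\<lambda>(i, l). line_center i + \<omega> (i, l)) ({1..7} \<times> {1..n})"
    and near: "\<And>i t. i \<in> {1..7} \<Longrightarrow> t \<in> {-1, 0, 1} \<Longrightarrow>
      \<exists>l\<in>{1..n}. norm (\<omega> (i, l) - t *\<^sub>R e1) \<le> 1/1000"
    and first: "\<And>i j. i \<in> {1..7} \<Longrightarrow> \<bar>\<Sum>l\<in>{1..n}. \<omega> (i, l) $ j\<bar> \<le> n / 1000"
    and second: "\<And>i j. i \<in> {1..7} \<Longrightarrow>
      \<bar>(\<Sum>l\<in>{1..n}. (\<omega> (i, l) $ j)\<^sup>2) - n * (m2 / 2)\<bar> \<le> n / 1000"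
    and m2: "m2 \<ge> 0.999"
  shows "\<not> exact_recovery 7 (sbm_cluster line_center n \<omega>)"
proof
  define C where "C = sbm_cluster line_center n \<omega>"
  define X where "X = (\<lambda>(i, l). line_center i + \<omega> (i, l))"
  define I where "I = {1..7::nat} \<times> {1..n}"
  define P where "P = (\<Union>i\<in>{1..7}. C i)"
  have C: "C i = (\<lambda>l. X (i, l)) ` {1..n}" for i
    by (simp add: C_def X_def sbm_cluster_def)
  have injX: "inj_on X I" using inj by (simp add: X_def I_def)
  have PX: "P = X ` I" by (auto simp: P_def C I_def)
  have disj: "disjoint_family_on C {1..7}"
    unfolding C_def using unit by (intro disjoint_line_clusters) auto
  have XC: "X (i, l) \<in> C i" if "l \<in> {1..n}" for i l
    using that by (auto simp: C)
  have finP: "finite P" by (auto simp: P_def C)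
  assume "exact_recovery 7 (sbm_cluster line_center n \<omega>)"
  then have "exact_recovery 7 C" by (simp add: C_def)
  then obtain q where q: "\<And>i. i \<in> {1..7} \<Longrightarrow> q i \<in> C i"
    and opt: "\<And>y z. lp_feasible P 7 y z \<Longrightarrow>
          (\<Sum>i\<in>{1..7}. \<Sum>p\<in>C i. dist (q i) p) \<le> lp_cost P z"
    using exact_recovery_medoids[of 7 C] disj unfolding P_def by (auto simp: C)

  \<comment> \<open>\<open>A i\<close> and \<open>B i\<close> are the left and right half facilities of ball \<open>i\<close>, near
    \<open>line_center i + tA i *\<^sub>R e1\<close> and \<open>line_center i + tB i *\<^sub>R e1\<close>.\<close>
  define tA where "tA i = (if i = (1::nat) then 0 else - 1 :: real)" for i
  define tB where "tB i = (if i = (7::nat) then 0 else 1 :: real)" for i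
  have "\<forall>i\<in>{1..7}. \<exists>l. l \<in> {1..n} \<and> norm (\<omega> (i, l) - tA i *\<^sub>R e1) \<le> 1/1000"
    using near[of _ "tA _"] unfolding Bex_def by (simp add: tA_def)
  from bchoice[OF this] obtain a where a: "\<And>i. i \<in> {1..7} \<Longrightarrow> a i \<in> {1..n}"
      "\<And>i. i \<in> {1..7} \<Longrightarrow> norm (\<omega> (i, a i) - tA i *\<^sub>R e1) \<le> 1/1000"
    by blast
  have "\<forall>i\<in>{1..7}. \<exists>l. l \<in> {1..n} \<and> norm (\<omega> (i, l) - tB i *\<^sub>R e1) \<le> 1/1000"
    using near[of _ "tB _"] unfolding Bex_def by (simp add: tB_def)
  from bchoice[OF this] obtain b where b: "\<And>i. i \<in> {1..7} \<Longrightarrow> b i \<in> {1..n}"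
      "\<And>i. i \<in> {1..7} \<Longrightarrow> norm (\<omega> (i, b i) - tB i *\<^sub>R e1) \<le> 1/1000"
    by blast
  define A where "A i = X (i, a i)" for i
  define B where "B i = X (i, b i)" for i
  have AC: "A i \<in> C i" and BC: "B i \<in> C i" if "i \<in> {1..7}" for i
    using XC a(1) b(1) that by (auto simp: A_def B_def)
  \<comment> \<open>The intended positions \<open>tA i\<close> and \<open>tB i\<close> differ by 1
    or 2, far more than twice the tolerance.\<close>
  have AB: "A i \<noteq> B i" if i: "i \<in> {1..7}" for i
  proof
    assume "A i = B i"
    then have "\<omega> (i, a i) = \<omega> (i, b i)" by (simp add: A_def B_def X_def)
    then have "(tB i - tA i) *\<^sub>R e1 = (\<omega> (i, a i) - tA i *\<^sub>R e1) - (\<omega> (i, b i) - tB i *\<^sub>R e1)"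
      by (simp add: scaleR_diff_left)
    then have "norm ((tB i - tA i) *\<^sub>R e1)
        \<le> norm (\<omega> (i, a i) - tA i *\<^sub>R e1) + norm (\<omega> (i, b i) - tB i *\<^sub>R e1)"
      by (metis norm_triangle_ineq4)
    then have "\<bar>tB i - tA i\<bar> \<le> 2/1000"
      using a(2)[OF i] b(2)[OF i] by simp
    then show False by (simp add: tA_def tB_def split: if_splits)
  qed
  define S where "S = (\<Union>i\<in>{1..7}. {A i, B i})"
  have across: "p \<noteq> p'" if "p \<in> C i" "p' \<in> C j" "i \<in> {1..7}" "j \<in> {1..7}" "i \<noteq> j" for p p' i j
    using disj that unfolding disjoint_family_on_def by blast
  have "card S = (\<Sum>i\<in>{1..7}. card {A i, B i})"
    unfolding S_def
  proof (rule card_UN_disjoint)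
    show "\<forall>i\<in>{1..7}. \<forall>j\<in>{1..7}. i \<noteq> j \<longrightarrow> {A i, B i} \<inter> {A j, B j} = {}"
    proof (intro ballI impI)
      fix i j :: nat assume "i \<in> {1..7}" "j \<in> {1..7}" "i \<noteq> j"
      then have "C i \<inter> C j = {}" "{A i, B i} \<subseteq> C i" "{A j, B j} \<subseteq> C j"
        using disj AC BC unfolding disjoint_family_on_def by blast+
      then show "{A i, B i} \<inter> {A j, B j} = {}" by blast
    qed
  qed auto
  also have "\<dots> = (\<Sum>i\<in>{1..7::nat}. 2)"
    using AB by (intro sum.cong) auto
  finally have cardS: "card S = 2 * 7" by simp
  have SP: "S \<subseteq> P" using AC BC unfolding S_def P_def by blast

  \<comment> \<open>For indices in \<open>I\<close> the branch with \<open>j - 1\<close> is reached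
    only if \<open>j \<ge> 2\<close>, so truncated subtraction is harmless. The borrowed facilities
    \<open>B (j - 1)\<close> and \<open>A (j + 1)\<close> are always at contact points, even when
    the neighbour is an extreme ball: the central ones are \<open>A 1\<close> and
    \<open>B 7\<close>.\<close>
  define F where "F = (\<lambda>(j, l). if j = 1 \<or> j = 7 \<or> \<omega> (j, l) $ 1 < 0 then A j else B j)"
  define G where "G = (\<lambda>(j, l). if j = 1 \<or> j = 7 then B j
    else if \<omega> (j, l) $ 1 < 0 then B (j - 1) else A (j + 1))"
  have FG: "F jl \<in> S \<and> G jl \<in> S \<and> F jl \<noteq> G jl" if jl: "jl \<in> I" for jl
  proof -
    obtain j l where [simp]: "jl = (j, l)" by (cases jl)
    have j: "j \<in> {1..7}" using jl by (simp add: I_def)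
    consider "j = 1 \<or> j = 7" | "2 \<le> j" "j \<le> 6"
      using j unfolding atLeastAtMost_iff by linarith
    then show ?thesis
    proof cases
      case 1
      then show ?thesis using AB j by (auto simp: F_def G_def S_def)
    next
      case 2
      then have nb: "j - 1 \<in> {1..7}" "j \<noteq> j - 1" "j + 1 \<in> {1..7}" "j \<noteq> j + 1" by auto
      have "A j \<noteq> B (j - 1)" "B j \<noteq> A (j + 1)"
        using across[OF AC[OF j] BC[OF nb(1)] j nb(1,2)] across[OF BC[OF j] AC[OF nb(3)] j nb(3,4)]
        by auto
      moreover have "A j \<in> S" "B j \<in> S" "B (j - 1) \<in> S" "A (j + 1) \<in> S"
        using j nb unfolding S_def by blast+
      ultimately show ?thesis using 2 by (simp add: F_def G_def)
    qed
  qed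
  \<comment> \<open>In the extreme balls the summand 1 bounds the distance to the centre and the
    other summand comes from the linear contact bound. The final 1/1000 pays for two facilities,
    each misplaced by up to 1/1000, at weight one half.\<close>
  define U where "U j v = (if j = (1::nat) then 1 + (3.96 - 2 * v) / 2.8
    else if j = 7 then 1 + (3.96 + 2 * v) / 2.8 else 3 - 2.45 * v\<^sup>2) / 2 + (1/1000 :: real)" for j v
  have cost: "(dist (F (j, l)) (X (j, l)) + dist (G (j, l)) (X (j, l))) / 2 \<le> U j (\<omega> (j, l) $ 1)"
    if jl: "j \<in> {1..7}" "l \<in> {1..n}" for j l
  proof -
    define v where "v = \<omega> (j, l)"
    have v: "norm v \<le> 1" using unit jl by (simp add: v_def)
    then have v': "norm (- v) \<le> 1" by simp
    have dA: "dist (A i) (X (j, l)) \<le> norm (v - (2.2 * (real i - real j) + tA i) *\<^sub>R e1) + 1/1000"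
      and dB: "dist (B i) (X (j, l)) \<le> norm (v - (2.2 * (real i - real j) + tB i) *\<^sub>R e1) + 1/1000"
      if "i \<in> {1..7}" for i
      unfolding A_def B_def X_def v_def prod.case
      using dist_shifted_facility[OF a(2)[OF that]] dist_shifted_facility[OF b(2)[OF that]] by blast+
    \<comment> \<open>The reflection of \<open>v\<close> turns left contact points into right ones,
      so the one-sided estimates cover both halves.\<close>
    have flip: "norm (- v - t *\<^sub>R e1) = norm (v - (- t) *\<^sub>R e1)" for t
    proof -
      have "- v - t *\<^sub>R e1 = - (v - (- t) *\<^sub>R e1)" by simp
      then show ?thesis by (metis norm_minus_cancel)
    qed
    have left: "norm (v - (- 1) *\<^sub>R e1) \<le> (3.96 + 2 * v $ 1) / 2.8"
      using norm_contact_le_linear[OF v'] flip[of 1] by (simp del: norm_minus_cancel)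
    have left2: "norm (v - (- 1) *\<^sub>R e1) + norm (v - (- 1.2) *\<^sub>R e1) \<le> 3 - 2.45 * (v $ 1)\<^sup>2"
      if "v $ 1 < 0"
    proof -
      have "norm (- v - 1 *\<^sub>R e1) + norm (- v - 1.2 *\<^sub>R e1) \<le> 3 - 2.45 * ((- v) $ 1)\<^sup>2"
        using norm_contacts_le[OF v'] that by simp
      then show ?thesis unfolding flip by simp
    qed
    consider "j = 1" | "j = 7" | "2 \<le> j" "j \<le> 6" "v $ 1 < 0" | "2 \<le> j" "j \<le> 6" "v $ 1 \<ge> 0"
      using jl(1) unfolding atLeastAtMost_iff by linarith
    then show ?thesis
    proof cases
      case 1
      then show ?thesis
        using dA[of 1] dB[of 1] norm_contact_le_linear[OF v] v
        unfolding F_def G_def U_def prod.case v_def[symmetric] by (simp add: tA_def tB_def field_simps)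
    next
      case 2
      then show ?thesis
        using dA[of 7] dB[of 7] left v
        unfolding F_def G_def U_def prod.case v_def[symmetric] by (simp add: tA_def tB_def field_simps)
    next
      case 3
      then have nb: "j - 1 \<in> {1..7}" by auto
      \<comment> \<open>Seen from the own centre, the right contact point of the left neighbour is
        at - 2.2 + 1 = - 1.2.\<close>
      have "2.2 * (real j - real j) + tA j = - 1" "2.2 * (real (j - 1) - real j) + tB (j - 1) = - 1.2"
        using 3 by (auto simp: tA_def tB_def of_nat_diff)
      then have "dist (A j) (X (j, l)) + dist (B (j - 1)) (X (j, l)) \<le> 3 - 2.45 * (v $ 1)\<^sup>2 + 2/1000"
        using dA[OF jl(1)] dB[OF nb] left2 3 by auto
      then show ?thesis
        using 3 unfolding F_def G_def U_def prod.case v_def[symmetric] by (simp add: field_simps)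
    next
      case 4
      then have nb: "j + 1 \<in> {1..7}" by auto
      have eq: "2.2 * (real j - real j) + tB j = 1" "2.2 * (real (j + 1) - real j) + tA (j + 1) = 1.2"
        using 4 by (auto simp: tA_def tB_def)
      have "dist (B j) (X (j, l)) + dist (A (j + 1)) (X (j, l)) \<le> 3 - 2.45 * (v $ 1)\<^sup>2 + 2/1000"
        using dB[OF jl(1), unfolded eq] dA[OF nb, unfolded eq] norm_contacts_le[OF v 4(3)] by simp
      then show ?thesis
        using 4 unfolding F_def G_def U_def prod.case v_def[symmetric] by (simp add: field_simps)
    qed
  qed
  \<comment> \<open>\<open>F\<close> and \<open>G\<close> are defined on indices, while the linear
    program speaks of points; injectivity lets \<alpha> recover the index of a point.\<close>
  define \<alpha> where "\<alpha> = inv_into I X"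
  have \<alpha>: "\<alpha> (X jl) = jl" if "jl \<in> I" for jl
    using injX that by (simp add: \<alpha>_def)
  have sumP: "(\<Sum>p\<in>P. f p) = (\<Sum>j\<in>{1..7}. \<Sum>l\<in>{1..n}. f (X (j, l)))" for f :: "_ \<Rightarrow> real"
    unfolding PX using injX by (simp add: sum.reindex sum.cartesian_product I_def case_prod_unfold)
  have FG\<alpha>: "F (\<alpha> p) \<in> S \<and> G (\<alpha> p) \<in> S \<and> F (\<alpha> p) \<noteq> G (\<alpha> p)" if "p \<in> P" for p
    using that FG \<alpha> unfolding PX by (metis imageE)
  note half = half_integral_feasible[OF finP SP cardS, of "\<lambda>p. F (\<alpha> p)" "\<lambda>p. G (\<alpha> p)", OF FG\<alpha>]
  have "(\<Sum>i\<in>{1..7}. \<Sum>p\<in>C i. dist (q i) p)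
      \<le> (\<Sum>p\<in>P. (dist (F (\<alpha> p)) p + dist (G (\<alpha> p)) p) / 2)"
    by (rule order_trans[OF opt[OF half(1)] eq_refl[OF half(2)]])
  also have "\<dots> = (\<Sum>j\<in>{1..7}. \<Sum>l\<in>{1..n}.
      (dist (F (j, l)) (X (j, l)) + dist (G (j, l)) (X (j, l))) / 2)"
    unfolding sumP by (intro sum.cong) (auto simp: \<alpha> I_def)
  also have "\<dots> \<le> (\<Sum>j\<in>{1..7}. \<Sum>l\<in>{1..n}. U j (\<omega> (j, l) $ 1))"
    using cost by (intro sum_mono) auto
  \<comment> \<open>Insert the moment bounds. Extreme balls: (1 + 3.96/2.8)/2 + 1/2800 + 1/1000 =
    1.2085. Interior balls: 1.5 + 0.001 + 0.001225 - 0.6125 \<open>m2\<close>, with the constant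
    rounded up to 1.5023.\<close>
  also have "\<dots> \<le> (\<Sum>j\<in>{1..7::nat}. n * (if j = 1 \<or> j = 7 then 1.2085 else 1.5023 - 0.6125 * m2))"
  proof (intro sum_mono)
    fix j :: nat assume j: "j \<in> {1..7}"
    define s1 where "s1 = (\<Sum>l\<in>{1..n}. \<omega> (j, l) $ 1)"
    define s2 where "s2 = (\<Sum>l\<in>{1..n}. (\<omega> (j, l) $ 1)\<^sup>2)"
    have s: "s1 \<le> n / 1000" "- s1 \<le> n / 1000" "n * m2 / 2 - n / 1000 \<le> s2"
      using first[OF j, of 1] second[OF j, of 1] unfolding s1_def s2_def by (simp_all only: abs_le_iff) linarith+
    have "(\<Sum>l\<in>{1..n}. U j (\<omega> (j, l) $ 1))
        = (if j = 1 then n * (1 + 3.96 / 2.8) - 2 / 2.8 * s1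
           else if j = 7 then n * (1 + 3.96 / 2.8) + 2 / 2.8 * s1 else 3 * n - 2.45 * s2) / 2 + n / 1000"
      unfolding U_def s1_def s2_def
      by (simp add: sum.distrib sum_subtractf add_divide_distrib diff_divide_distrib
          sum_distrib_left sum_divide_distrib algebra_simps)
    also have "\<dots> \<le> n * (if j = 1 \<or> j = 7 then 1.2085 else 1.5023 - 0.6125 * m2)"
      using s by (auto simp: field_simps)
    finally show "(\<Sum>l\<in>{1..n}. U j (\<omega> (j, l) $ 1)) \<le> \<dots>" .
  qed
  also have "\<dots> = n * (2 * 1.2085 + 5 * (1.5023 - 0.6125 * m2))"
  proof -
    have "(\<Sum>j\<in>{1..7::nat}. n * (if j = 1 \<or> j = 7 then x else y)) = n * (2 * x + 5 * y)" for x y :: real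
      by (simp add: numeral_eq_Suc algebra_simps)
    then show ?thesis .
  qed
  finally have upper: "(\<Sum>i\<in>{1..7}. \<Sum>p\<in>C i. dist (q i) p) \<le> n * (2 * 1.2085 + 5 * (1.5023 - 0.6125 * m2))" .

  \<comment> \<open>The loss 0.004 per ball and point collects four deviations of 1/1000: two second
    moments and two first moments.\<close>
  have "n * (7 * (m2 - 0.004)) = (\<Sum>i\<in>{1..7::nat}. n * (m2 - 0.004))"
    unfolding sum_constant by simp
  also have "\<dots> \<le> (\<Sum>i\<in>{1..7}. \<Sum>p\<in>C i. dist (q i) p)"
  proof (intro sum_mono)
    fix i :: nat assume i: "i \<in> {1..7}"
    have "q i \<in> (\<lambda>l. X (i, l)) ` {1..n}" using q[OF i] by (simp only: C)
    then obtain l0 where l0: "l0 \<in> {1..n}" "q i = X (i, l0)" by (rule imageE)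
    have injXi: "inj_on (\<lambda>l. X (i, l)) {1..n}"
    proof (rule inj_onI)
      fix l l' assume "l \<in> {1..n}" "l' \<in> {1..n}" "X (i, l) = X (i, l')"
      then have "(i, l) = (i, l')" using i by (intro inj_onD[OF injX]) (simp_all add: I_def)
      then show "l = l'" by simp
    qed
    have sq: "n * (m2 / 2) - n / 1000 \<le> (\<Sum>l\<in>{1..n}. (\<omega> (i, l) $ j)\<^sup>2)" for j
      using second[OF i, of j] by (simp only: abs_diff_le_iff)
    have "n * (m2 - 0.004) = n * (m2 / 2) + n * (m2 / 2) - 4 * (n / 1000)"
      by (simp add: field_simps)
    also have "\<dots> = (n * (m2 / 2) - n / 1000) + (n * (m2 / 2) - n / 1000) - n / 1000 - n / 1000"
      by simp
    also have "\<dots> \<le> (\<Sum>l\<in>{1..n}. (\<omega> (i, l) $ 1)\<^sup>2) + (\<Sum>l\<in>{1..n}. (\<omega> (i, l) $ 2)\<^sup>2)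
        - \<bar>\<Sum>l\<in>{1..n}. \<omega> (i, l) $ 1\<bar> - \<bar>\<Sum>l\<in>{1..n}. \<omega> (i, l) $ 2\<bar>"
      by (intro add_mono diff_mono sq first i)
    also have "\<dots> \<le> (\<Sum>l\<in>{1..n}. norm (\<omega> (i, l) - \<omega> (i, l0)))"
      by (rule sum_norm_diff_ge) (rule unit[OF i], assumption, rule unit[OF i l0(1)])
    also have "\<dots> = (\<Sum>l\<in>{1..n}. dist (q i) (X (i, l)))"
      by (intro sum.cong) (simp_all add: l0(2) X_def dist_norm norm_minus_commute)
    also have "\<dots> = (\<Sum>p\<in>C i. dist (q i) p)"
      unfolding C sum.reindex[OF injXi] by simp
    finally show "n * (m2 - 0.004) \<le> (\<Sum>p\<in>C i. dist (q i) p)" .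
  qed
  also note upper
  \<comment> \<open>This says 10.0625 \<open>m2\<close> \<le> 9.9565, hence \<open>m2\<close> <
    0.99, contrary to \<open>m2 \<ge> 0.999\<close>.\<close>
  finally have "7 * (m2 - 0.004) \<le> 2 * 1.2085 + 5 * (1.5023 - 0.6125 * m2)"
    by (rule mult_left_le_imp_le) (use n in simp)
  then show False using m2 by simp
qed

section \<open>A radial distribution concentrated near the unit circle\<close>

text \<open>Lebesgue measure is determined by its values on boxes. The preimage of a box under
  \<open>Q\<close> is its image under the inverse \<open>transpose Q\<close>, and orthogonal images
  preserve measure.\<close>

lemma distr_lborel_orthogonal:
  fixes Q :: "real ^ 'n::{finite,wellorder} ^ 'n::_"
  assumes Q: "orthogonal_matrix Q"
  shows "distr lborel borel (\<lambda>v. Q *v v) = lborel"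
proof (rule lborel_eqI[symmetric])
  fix l u :: "real ^ 'n::_"
  assume lu: "\<And>b. b \<in> Basis \<Longrightarrow> l \<bullet> b \<le> u \<bullet> b"
  have QQ: "Q ** transpose Q = mat 1" "transpose Q ** Q = mat 1"
    using Q by (auto simp: orthogonal_matrix_def)
  have pre: "(\<lambda>v. Q *v v) -` box l u = (\<lambda>v. transpose Q *v v) ` box l u" (is "?pre = ?im")
  proof
    show "?pre \<subseteq> ?im"
    proof
      fix v assume "v \<in> ?pre"
      moreover have "v = transpose Q *v (Q *v v)" 
        by (simp add: matrix_vector_mul_assoc QQ del: transpose_matrix_vector)
      ultimately show "v \<in> ?im" by blast
    qed
    show "?im \<subseteq> ?pre"
      by (auto simp: matrix_vector_mul_assoc QQ simp del: transpose_matrix_vector)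
  qed
  have "orthogonal_transformation (\<lambda>v. transpose Q *v v)"
    using Q by (simp add: orthogonal_transformation_matrix orthogonal_matrix_transpose
        matrix_of_matrix_vector_mul del: transpose_matrix_vector)
  then have im: "?im \<in> lmeasurable" "measure lebesgue ?im = measure lebesgue (box l u)"
    by (simp_all add: measurable_orthogonal_image measure_orthogonal_image)
  have [measurable]: "(\<lambda>v. Q *v v) \<in> borel_measurable borel"
    by (intro borel_measurable_continuous_onI linear_continuous_on matrix_vector_mul_bounded_linear)
  have "?pre \<in> sets borel"
    by (metis (no_types) measurable_sets_borel[of "\<lambda>v. Q *v v" borel "box l u"] borel_open open_box
        \<open>(\<lambda>v. Q *v v) \<in> borel_measurable borel\<close>)
  then have "emeasure (distr lborel borel (\<lambda>v. Q *v v)) (box l u) = emeasure lebesgue ?im"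
    by (simp add: emeasure_distr pre)
  also have "\<dots> = ennreal (measure lebesgue (box l u))"
    using im by (simp add: emeasure_eq_measure2)
  also have "\<dots> = (\<Prod>b\<in>Basis. (u - l) \<bullet> b)"
    using lu by (simp add: measure_lborel_box_eq)
  finally show "emeasure (distr lborel borel (\<lambda>v. Q *v v)) (box l u) = (\<Prod>b\<in>Basis. (u - l) \<bullet> b)" .
qed simp

lemma emeasure_density_cball:
  fixes f :: "real ^ 'n \<Rightarrow> ennreal"
  assumes [measurable]: "f \<in> borel_measurable borel"
    and A: "A \<in> sets (restrict_space borel (cball 0 1))"
  shows "emeasure (density (restrict_space lborel (cball 0 1)) f) A
    = (\<integral>\<^sup>+x. f x * indicator A x \<partial>lborel)"
proof -
  have A': "A \<subseteq> cball 0 1" "A \<in> sets borel"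
    using A by (auto simp: sets_restrict_space)
  have "emeasure (density (restrict_space lborel (cball 0 1)) f) A
      = (\<integral>\<^sup>+x. f x * indicator A x \<partial>restrict_space lborel (cball 0 1))"
    using A by (intro emeasure_density) (auto simp: measurable_restrict_space1 sets_restrict_space)
  also have "\<dots> = (\<integral>\<^sup>+x. f x * indicator A x * indicator (cball 0 1) x \<partial>lborel)"
    by (rule nn_integral_restrict_space) simp
  also have "\<dots> = (\<integral>\<^sup>+x. f x * indicator A x \<partial>lborel)"
    using A' by (intro nn_integral_cong) (auto simp: indicator_def)
  finally show ?thesis .
qed

lemma sets_density_cball:
  "sets (density (restrict_space lborel (cball 0 1)) f) = sets (restrict_space borel (cball 0 1))"
  unfolding sets_density by (rule sets_restrict_space_cong) (rule sets_lborel)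

lemma space_density_cball:
  "space (density (restrict_space lborel (cball 0 1)) f) = cball 0 1"
  by (simp add: space_restrict_space)

text \<open>Change of variables: both the weight and the ball depend on the norm only, and Lebesgue
  measure is preserved by \<open>Q\<close>.\<close>

lemma rotation_invariant_radial:
  fixes h :: "real \<Rightarrow> ennreal"
  defines "mu \<equiv> density (restrict_space lborel (cball (0 :: real ^ 'n::{finite,wellorder}) 1)) (\<lambda>x. h (norm x))"
  assumes [measurable]: "h \<in> borel_measurable borel"
  shows "rotation_invariant mu"
  unfolding rotation_invariant_def
proof (intro allI impI)
  fix Q :: "real ^ 'n::_ ^ 'n::_" assume "rotation_matrix Q"
  then have orth: "orthogonal_matrix Q" by (simp add: rotation_matrix_def)
  then have norm_Q: "norm (Q *v v) = norm v" for v
    using orthogonal_transformation_matrix[of "\<lambda>v. Q *v v"] orthogonal_transformation_norm by auto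
  have sets_mu: "sets mu = sets (restrict_space borel (cball 0 1))"
    unfolding mu_def by (rule sets_density_cball)
  have space_mu: "space mu = cball 0 1" unfolding mu_def by (rule space_density_cball)
  have Q_borel [measurable]: "(\<lambda>v. Q *v v) \<in> borel_measurable borel"
    by (intro borel_measurable_continuous_onI linear_continuous_on matrix_vector_mul_bounded_linear)
  have Q_meas: "(\<lambda>v. Q *v v) \<in> measurable mu mu"
    unfolding measurable_cong_sets[OF sets_mu sets_mu]
    by (intro measurable_restrict_space2 measurable_restrict_space1 Q_borel)
       (auto simp: space_restrict_space norm_Q)
  show "distr mu mu (\<lambda>v. Q *v v) = mu"
  proof (rule measure_eqI)
    fix A assume "A \<in> sets (distr mu mu (\<lambda>v. Q *v v))"
    then have A: "A \<in> sets mu" by simp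
    then have [measurable]: "A \<in> sets borel" and "A \<subseteq> cball 0 1"
      by (auto simp: sets_mu sets_restrict_space)
    let ?B = "(\<lambda>v. Q *v v) -` A \<inter> space mu"
    have B: "?B \<in> sets mu" using Q_meas A by (rule measurable_sets)
    have "emeasure (distr mu mu (\<lambda>v. Q *v v)) A = emeasure mu ?B"
      using Q_meas A by (rule emeasure_distr)
    also have "\<dots> = (\<integral>\<^sup>+x. h (norm x) * indicator ?B x \<partial>lborel)"
      unfolding mu_def using B[unfolded sets_mu] by (intro emeasure_density_cball) (auto simp: mu_def)
    also have "\<dots> = (\<integral>\<^sup>+x. h (norm (Q *v x)) * indicator A (Q *v x) \<partial>lborel)"
      using \<open>A \<subseteq> cball 0 1\<close> norm_Q
      by (intro nn_integral_cong) (auto simp: space_mu indicator_def subset_iff)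
    also have "\<dots> = (\<integral>\<^sup>+x. h (norm x) * indicator A x \<partial>distr lborel borel (\<lambda>v. Q *v v))"
      by (subst nn_integral_distr) simp_all
    also have "\<dots> = emeasure mu A"
      unfolding distr_lborel_orthogonal[OF orth] mu_def
      using A[unfolded sets_mu] by (intro emeasure_density_cball[symmetric]) auto
    finally show "emeasure (distr mu mu (\<lambda>v. Q *v v)) A = emeasure mu A" .
  qed simp
qed

text \<open>One family meets all requirements: the density is continuous and radial, it vanishes at
  most at the origin and so charges every open set meeting the open ball, and the mass drifts to the
  sphere as \<open>K\<close> grows.\<close>

definition radial_power_measure :: "nat \<Rightarrow> (real ^ 'n) measure" where
  "radial_power_measure K = (let Z = LBINT x:cball (0 :: real ^ 'n) 1. norm x ^ K in
     density (restrict_space lborel (cball 0 1)) (\<lambda>x. ennreal (norm x ^ K / Z)))"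

lemma integrable_norm_power:
  fixes S :: "(real ^ 'n) set"
  assumes "S \<subseteq> cball 0 1" "S \<in> sets borel"
  shows "set_integrable lborel S (\<lambda>x. norm x ^ K)"
proof -
  have "set_integrable lborel (cball 0 1) (\<lambda>x :: real ^ 'n. norm x ^ K)"
    unfolding set_integrable_def by (intro borel_integrable_compact continuous_intros) auto
  then show ?thesis
    using assms by (rule_tac set_integrable_subset) auto
qed

text \<open>Nonempty open sets are not negligible. Boundedness keeps the mass finite, since
  \<open>measure\<close> would turn infinite mass into 0.\<close>

lemma measure_lborel_open_pos:
  fixes U :: "(real ^ 'n) set"
  assumes "open U" "U \<noteq> {}" "bounded U"
  shows "measure lborel U > 0"
proof -
  have "emeasure lborel U \<noteq> 0"
    using assms(1,2) open_not_negligible[of U] negligible_iff_emeasure0[of U]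
    by (metis borel_open emeasure_completion main_part_sets negligible_iff_null_sets null_setsI null_sets_completionI sets_lborel)
  then show ?thesis
    using emeasure_bounded_finite[OF assms(3)]
    by (simp add: measure_def enn2real_positive_iff top.not_eq_extremum zero_less_iff_neq_zero)
qed

lemma set_integral_norm_power_ge:
  fixes S :: "(real ^ 'n) set"
  assumes "S \<subseteq> cball 0 1" "S \<in> sets borel" and \<sigma>: "0 \<le> \<sigma>" "\<And>x. x \<in> S \<Longrightarrow> \<sigma> \<le> norm x"
  shows "\<sigma> ^ K * measure lborel S \<le> (LBINT x:cball (0 :: real ^ 'n) 1. norm x ^ K)"
proof -
  have fin: "emeasure lborel S < \<infinity>"
    by (rule emeasure_bounded_finite[OF bounded_subset[OF bounded_cball assms(1)]])
  then have "\<sigma> ^ K * measure lborel S = (LBINT x:S. \<sigma> ^ K)"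
    using assms(2) by (simp add: set_lebesgue_integral_def mult.commute)
  also have "\<dots> \<le> (LBINT x:S. norm x ^ K)"
    using assms fin integrable_norm_power[OF assms(1,2)]
    by (intro set_integral_mono) (auto simp: set_integrable_def intro!: power_mono)
  also have "\<dots> \<le> (LBINT x:cball (0 :: real ^ 'n) 1. norm x ^ K)"
    unfolding set_lebesgue_integral_def
  proof (rule Bochner_Integration.integral_mono)
    show "integrable lborel (\<lambda>x. indicator S x *\<^sub>R norm x ^ K)"
      "integrable lborel (\<lambda>x :: real ^ 'n. indicator (cball 0 1) x *\<^sub>R norm x ^ K)"
      using integrable_norm_power[OF assms(1,2), of K]
        integrable_norm_power[of "cball (0 :: real ^ 'n) 1" K] by (simp_all add: set_integrable_def)
    show "indicator S x *\<^sub>R norm x ^ K \<le> indicator (cball 0 1) x *\<^sub>R norm x ^ K" for x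
      using assms(1) by (auto simp: indicator_def)
  qed
  finally show ?thesis .
qed

lemma set_integral_norm_power_le:
  fixes S :: "(real ^ 'n) set"
  assumes "S \<subseteq> cball 0 1" "S \<in> sets borel" and \<rho>: "\<And>x. x \<in> S \<Longrightarrow> norm x \<le> \<rho>"
  shows "(LBINT x:S. norm x ^ K) \<le> \<rho> ^ K * measure lborel S"
proof -
  have fin: "emeasure lborel S < \<infinity>"
    by (rule emeasure_bounded_finite[OF bounded_subset[OF bounded_cball assms(1)]])
  have "(LBINT x:S. norm x ^ K) \<le> (LBINT x:S. \<rho> ^ K)"
    using assms fin integrable_norm_power[OF assms(1,2)]
    by (intro set_integral_mono) (auto simp: set_integrable_def intro!: power_mono)
  also have "\<dots> = \<rho> ^ K * measure lborel S"
    using assms(2) fin by (simp add: set_lebesgue_integral_def mult.commute)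
  finally show ?thesis .
qed

lemma norm_power_mass_pos: "(LBINT x:cball (0 :: real ^ 'n) 1. norm x ^ K) > 0"
proof -
  let ?U = "ball (0 :: real ^ 'n) 1 - cball 0 (1/2)"
  \<comment> \<open>The annulus \<open>?U\<close> stays away from the origin, where the integrand
    may vanish. \<open>axis undefined 1\<close> is just some unit vector.\<close>
  have "(3/4) *\<^sub>R axis undefined 1 \<in> ?U" by simp
  then have ne: "?U \<noteq> {}" by blast
  have "measure lborel ?U > 0"
    by (rule measure_lborel_open_pos[OF _ ne]) (auto intro: bounded_diff)
  then have "0 < (1/2) ^ K * measure lborel ?U" by simp
  also have "\<dots> \<le> (LBINT x:cball (0 :: real ^ 'n) 1. norm x ^ K)"
    by (rule set_integral_norm_power_ge) auto
  finally show ?thesis .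
qed

lemma sets_radial_power: "sets (radial_power_measure K) = sets (restrict_space borel (cball 0 1))"
  by (simp only: radial_power_measure_def Let_def sets_density_cball)

lemma space_radial_power: "space (radial_power_measure K) = cball 0 1"
  by (simp only: radial_power_measure_def Let_def space_density_cball)

lemma emeasure_radial_power:
  fixes A :: "(real ^ 'n) set"
  assumes "A \<in> sets (radial_power_measure K)"
  shows "emeasure (radial_power_measure K) A
    = ennreal ((LBINT x:A. norm x ^ K) / (LBINT x:cball (0 :: real ^ 'n) 1. norm x ^ K))"
proof -
  define Z where "Z = (LBINT x:cball (0 :: real ^ 'n) 1. norm x ^ K)"
  have A: "A \<in> sets borel" "A \<subseteq> cball 0 1"
    using assms by (auto simp: sets_radial_power sets_restrict_space)
  have "Z > 0" by (simp add: Z_def norm_power_mass_pos)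
  have "emeasure (radial_power_measure K) A = (\<integral>\<^sup>+x. ennreal (norm x ^ K / Z) * indicator A x \<partial>lborel)"
    using assms unfolding sets_radial_power
    unfolding radial_power_measure_def Let_def Z_def by (rule emeasure_density_cball[rotated]) measurable
  also have "\<dots> = (\<integral>\<^sup>+x. ennreal (indicator A x *\<^sub>R norm x ^ K / Z) \<partial>lborel)"
    by (intro nn_integral_cong) (auto simp: indicator_def)
  also have "\<dots> = ennreal (\<integral>x. indicator A x *\<^sub>R norm x ^ K / Z \<partial>lborel)"
    using integrable_norm_power[OF A(2,1), of K] \<open>Z > 0\<close> unfolding set_integrable_def
    by (intro nn_integral_eq_integral) auto
  finally show ?thesis by (simp add: set_lebesgue_integral_def Z_def)
qed

lemma prob_space_radial_power: "prob_space (radial_power_measure K :: (real ^ 'n) measure)"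
proof
  have "cball 0 1 \<in> sets (radial_power_measure K :: (real ^ 'n) measure)"
    using sets.top[of "radial_power_measure K :: (real ^ 'n) measure"] by (simp add: space_radial_power)
  then show "emeasure (radial_power_measure K) (space (radial_power_measure K :: (real ^ 'n) measure)) = 1"
    using norm_power_mass_pos[where 'n = 'n, of K]
    by (simp add: emeasure_radial_power space_radial_power)
qed

lemma unit_ball_distribution_radial_power: "unit_ball_distribution (radial_power_measure K)"
  by (simp add: unit_ball_distribution_def prob_space_radial_power sets_radial_power)

lemma has_continuous_density_radial_power: "has_continuous_density (radial_power_measure K :: (real ^ 'n) measure)"
  unfolding has_continuous_density_def radial_power_measure_def Let_def
  using norm_power_mass_pos[where 'n = 'n, of K]
  by (intro exI[of _ "\<lambda>x. norm x ^ K / (LBINT x:cball (0 :: real ^ 'n) 1. norm x ^ K)"])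
     (auto intro!: continuous_intros)

lemma rotation_invariant_radial_power:
  "rotation_invariant (radial_power_measure K :: (real ^ 'n::{finite,wellorder}) measure)"
  unfolding radial_power_measure_def Let_def
  by (rule rotation_invariant_radial[of "\<lambda>r. ennreal (r ^ K / (LBINT x:cball (0 :: real ^ 'n::_) 1. norm x ^ K))"])
     measurable

lemma measure_radial_power:
  fixes A :: "(real ^ 'n) set"
  assumes "A \<in> sets (radial_power_measure K)"
  shows "measure (radial_power_measure K) A
    = (LBINT x:A. norm x ^ K) / (LBINT x:cball (0 :: real ^ 'n) 1. norm x ^ K)"
proof -
  have "(LBINT x:A. norm x ^ K) \<ge> 0"
    unfolding set_lebesgue_integral_def by (intro integral_nonneg_AE) auto
  then show ?thesis
    using norm_power_mass_pos[where 'n = 'n, of K]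
    by (simp add: measure_def emeasure_radial_power[OF assms])
qed

lemma radial_power_no_atoms:
  assumes "x \<in> cball 0 1"
  shows "emeasure (radial_power_measure K) {x :: real ^ 'n} = 0"
proof -
  have "{x} \<in> sets (radial_power_measure K)"
    using assms by (auto simp: sets_radial_power sets_restrict_space)
  moreover have "AE y in lborel. indicator {x} y *\<^sub>R norm y ^ K = 0"
    using AE_lborel_singleton[of x] by eventually_elim (simp add: indicator_def)
  then have "(LBINT y:{x}. norm y ^ K) = 0"
    unfolding set_lebesgue_integral_def by (rule integral_eq_zero_AE)
  ultimately show ?thesis by (simp add: emeasure_radial_power)
qed

lemma radial_power_open_pos:
  fixes U :: "(real ^ 'n) set"
  assumes "open U" "U \<inter> ball 0 1 \<noteq> {}"
  shows "measure (radial_power_measure K) (U \<inter> cball 0 1) > 0"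
proof -
  \<comment> \<open>The origin is removed because the density may vanish there; a small closed ball
    inside \<open>?W\<close> then has norms bounded below by a positive \<open>d\<close>.\<close>
  let ?W = "U \<inter> ball 0 1 - {0}"
  have "open ?W" using assms(1) by auto
  moreover have "?W \<noteq> {}"
  proof
    assume "?W = {}"
    then have "U \<inter> ball 0 1 = {0}" using assms(2) by auto
    moreover have "open (U \<inter> ball 0 1)" using assms(1) by auto
    ultimately show False using not_open_singleton by metis
  qed
  ultimately obtain w \<epsilon> where w: "\<epsilon> > 0" "cball w \<epsilon> \<subseteq> ?W"
    by (meson all_not_in_conv open_contains_cball)
  then have "0 \<notin> cball w \<epsilon>" by blast
  then obtain d where d: "d > 0" "\<And>x. x \<in> cball w \<epsilon> \<Longrightarrow> d \<le> norm x"
    using separate_point_closed[OF closed_cball, of 0 w \<epsilon>] by (metis dist_0_norm)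
  have sub: "ball w \<epsilon> \<subseteq> cball 0 1" and sub': "ball w \<epsilon> \<subseteq> U \<inter> cball 0 1"
    using w(2) ball_subset_cball[of w \<epsilon>] ball_subset_cball[of "0 :: real ^ 'n" 1] by blast+
  have int: "(LBINT x:ball w \<epsilon>. norm x ^ K) > 0"
  proof -
    have "0 < d ^ K * measure lborel (ball w \<epsilon>)"
      using w(1) d(1) by (intro mult_pos_pos measure_lborel_open_pos) auto
    also have "\<dots> = (LBINT x:ball w \<epsilon>. d ^ K)"
      using emeasure_bounded_finite[of "ball w \<epsilon>"] by (simp add: set_lebesgue_integral_def)
    also have "\<dots> \<le> (LBINT x:ball w \<epsilon>. norm x ^ K)"
      using d integrable_norm_power[OF sub, of K] emeasure_bounded_finite[of "ball w \<epsilon>"]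
      by (intro set_integral_mono) (auto simp: set_integrable_def intro!: power_mono)
    finally show ?thesis .
  qed
  interpret prob_space "radial_power_measure K :: (real ^ 'n) measure" by (rule prob_space_radial_power)
  have "0 < measure (radial_power_measure K) (ball w \<epsilon>)"
    using int norm_power_mass_pos[where 'n = 'n, of K] sub
    by (subst measure_radial_power) (auto simp: sets_radial_power sets_restrict_space)
  also have "\<dots> \<le> measure (radial_power_measure K) (U \<inter> cball 0 1)"
    using sub' assms(1)
    by (intro finite_measure_mono) (auto simp: sets_radial_power sets_restrict_space)
  finally show ?thesis .
qed

lemma charges_nbhds_radial_power: "charges_nbhds_of_0 (radial_power_measure K)"
  unfolding charges_nbhds_of_0_def
proof (intro allI impI)
  fix U :: "(real ^ 'n) set"
  assume U: "openin (top_of_set (cball 0 1)) U \<and> 0 \<in> U"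
  then obtain V where V: "open V" "U = cball 0 1 \<inter> V" by (auto simp: openin_open)
  then have "V \<inter> ball 0 1 \<noteq> {}" using U by force
  then show "measure (radial_power_measure K) U > 0"
    using radial_power_open_pos[OF V(1), of K] V(2) by (simp add: Int_commute)
qed

text \<open>Fix radii \<rho> < \<sigma> < 1 with \<eta> < \<rho>^2. The integral over the ball of
  radius \<rho> is at most a multiple of \<rho>^K, the normaliser is at least a multiple of
  \<sigma>^K because of the annulus beyond \<sigma>. So the inner ball loses its mass geometrically,
  and the rest contributes at least \<rho>^2 times its mass.\<close>

lemma radial_power_second_moment:
  assumes "\<eta> < 1"
  shows "\<exists>K. (\<integral>v. (norm v)\<^sup>2 \<partial>radial_power_measure K :: (real ^ 'n) measure) > \<eta>"
proof -
  obtain \<rho> \<sigma> :: real where \<rho>: "0 < \<rho>" "\<rho> < \<sigma>" "\<sigma> < 1" "\<eta> < \<rho>\<^sup>2"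
  proof -
    have "((\<lambda>r :: real. r\<^sup>2) \<longlongrightarrow> 1\<^sup>2) (at_left 1)" by (intro tendsto_intros)
    then have "eventually (\<lambda>r :: real. \<eta> < r\<^sup>2) (at_left 1)"
      using assms by (intro order_tendstoD) auto
    moreover have "eventually (\<lambda>r :: real. r \<in> {0<..<1}) (at_left 1)"
      by (rule eventually_at_leftI[of 0]) auto
    ultimately have "eventually (\<lambda>r :: real. \<eta> < r\<^sup>2 \<and> r \<in> {0<..<1}) (at_left 1)"
      by (rule eventually_conj)
    then obtain r :: real where "\<eta> < r\<^sup>2" "0 < r" "r < 1"
      using eventually_happens[of _ "at_left (1::real)"] by auto
    then show thesis using that[of r "(r + 1) / 2"] by simp
  qed
  define V where "V = measure lborel (ball (0 :: real ^ 'n) 1 - cball 0 \<sigma>)"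
  define B where "B = measure lborel (cball (0 :: real ^ 'n) \<rho>)"
  have "((1 + \<sigma>) / 2) *\<^sub>R axis undefined 1 \<in> ball (0 :: real ^ 'n) 1 - cball 0 \<sigma>"
    using \<rho> by simp
  then have "V > 0"
    unfolding V_def by (intro measure_lborel_open_pos) (blast intro: bounded_diff bounded_ball)+
  have B: "B \<ge> 0" by (simp add: B_def)
  have "(\<lambda>K. \<rho>\<^sup>2 * (1 - (\<rho> / \<sigma>) ^ K * (B / V))) \<longlonglongrightarrow> \<rho>\<^sup>2 * (1 - 0 * (B / V))"
    using \<rho> by (intro tendsto_intros LIMSEQ_power_zero) auto
  then have "eventually (\<lambda>K. \<eta> < \<rho>\<^sup>2 * (1 - (\<rho> / \<sigma>) ^ K * (B / V))) sequentially"
    using \<rho>(4) by (intro order_tendstoD) auto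
  then obtain K where K: "\<eta> < \<rho>\<^sup>2 * (1 - (\<rho> / \<sigma>) ^ K * (B / V))"
    using eventually_happens[of _ sequentially] by auto
  define mu :: "(real ^ 'n) measure" where "mu = radial_power_measure K"
  interpret prob_space mu unfolding mu_def by (rule prob_space_radial_power)
  define Z where "Z = (LBINT x:cball (0 :: real ^ 'n) 1. norm x ^ K)"
  have Z: "Z \<ge> \<sigma> ^ K * V"
    unfolding Z_def V_def using \<rho> by (intro set_integral_norm_power_ge) auto
  have sets_mu: "sets mu = sets (restrict_space borel (cball 0 1))" and space_mu: "space mu = cball 0 1"
    by (simp_all only: mu_def sets_radial_power space_radial_power)
  have in_ball: "cball 0 \<rho> \<in> sets mu"
    using \<rho> by (auto simp: sets_mu sets_restrict_space intro!: image_eqI[of _ _ "cball 0 \<rho>"])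
  have "prob (cball 0 \<rho>) = (LBINT x:cball (0 :: real ^ 'n) \<rho>. norm x ^ K) / Z"
    using in_ball unfolding mu_def Z_def by (rule measure_radial_power)
  also have "\<dots> \<le> (\<rho> ^ K * B) / (\<sigma> ^ K * V)"
  proof (rule frac_le)
    have "cball (0 :: real ^ 'n) \<rho> \<subseteq> cball 0 1" using \<rho> by auto
    then show "(LBINT x:cball (0 :: real ^ 'n) \<rho>. norm x ^ K) \<le> \<rho> ^ K * B"
      unfolding B_def by (rule set_integral_norm_power_le) auto
  qed (use \<rho> Z \<open>V > 0\<close> B in auto)
  also have "\<dots> = (\<rho> / \<sigma>) ^ K * (B / V)" by (simp add: power_divide)
  finally have small: "prob (cball 0 \<rho>) \<le> (\<rho> / \<sigma>) ^ K * (B / V)" .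
  have meas: "(\<lambda>v. norm v) \<in> borel_measurable mu"
    unfolding measurable_cong_sets[OF sets_mu refl] by (intro measurable_restrict_space1) simp
  have "\<eta> < \<rho>\<^sup>2 * (1 - prob (cball 0 \<rho>))"
    using K small \<rho> by (smt (verit) mult_left_mono zero_le_power2)
  also have "\<dots> = (\<integral>v. \<rho>\<^sup>2 * (1 - indicator (cball 0 \<rho>) v) \<partial>mu)"
  proof -
    have "(\<integral>v. 1 - indicator (cball 0 \<rho>) v \<partial>mu) = 1 - prob (cball 0 \<rho>)"
      using in_ball by (subst Bochner_Integration.integral_diff) 
        (auto simp: prob_space emeasure_eq_measure intro!: integrable_real_indicator)
    then show ?thesis by simp
  qed
  also have "\<dots> \<le> (\<integral>v. (norm v)\<^sup>2 \<partial>mu)"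
  proof (rule Bochner_Integration.integral_mono)
    show "integrable mu (\<lambda>v. \<rho>\<^sup>2 * (1 - indicator (cball 0 \<rho>) v))"
      using in_ball by (intro integrable_mult_right Bochner_Integration.integrable_diff)
        (auto simp: emeasure_eq_measure intro!: integrable_real_indicator)
    show "integrable mu (\<lambda>v. (norm v)\<^sup>2)"
      by (rule integrable_const_bound[where B = 1])
         (use meas in \<open>auto simp: space_mu power_le_one intro!: AE_I2\<close>)
    show "\<rho>\<^sup>2 * (1 - indicator (cball 0 \<rho>) v) \<le> (norm v)\<^sup>2" for v
      using \<rho> by (auto simp: indicator_def intro!: power_mono)
  qed
  finally show ?thesis unfolding mu_def by blast
qed

section \<open>Concentration and distinctness of the sample\<close>

lemma prob_space_sbm_space: "prob_space mu \<Longrightarrow> prob_space (sbm_space mu k n)"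
  unfolding sbm_space_def by (rule prob_space_PiM)

text \<open>Independence means that the joint law is the product of the marginals; here the joint
  law of the coordinates is the product measure itself.\<close>

lemma indep_vars_PiM_components:
  assumes "prob_space mu" "I \<noteq> {}"
  shows "prob_space.indep_vars (\<Pi>\<^sub>M i\<in>I. mu) (\<lambda>_. mu) (\<lambda>i \<omega>. \<omega> i) I"
proof -
  interpret P: prob_space "\<Pi>\<^sub>M i\<in>I. mu" using assms(1) by (rule prob_space_PiM)
  have "distr (\<Pi>\<^sub>M i\<in>I. mu) (\<Pi>\<^sub>M i\<in>I. mu) (\<lambda>x. \<lambda>i\<in>I. x i)
      = distr (\<Pi>\<^sub>M i\<in>I. mu) (\<Pi>\<^sub>M i\<in>I. mu) (\<lambda>x. x)"
    by (intro distr_cong) (auto simp: space_PiM PiE_def extensional_def restrict_def)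
  also have "\<dots> = (\<Pi>\<^sub>M i\<in>I. mu)" by (rule distr_id)
  also have "\<dots> = (\<Pi>\<^sub>M i\<in>I. distr (\<Pi>\<^sub>M i\<in>I. mu) mu (\<lambda>\<omega>. \<omega> i))"
    using assms(1) by (intro PiM_cong) (simp_all add: distr_PiM_component[of I "\<lambda>_. mu"])
  finally show ?thesis
    using assms(2) by (subst P.indep_vars_iff_distr_eq_PiM') auto
qed

lemma sbm_concentration:
  fixes \<epsilon> :: real
  assumes mu: "prob_space mu" and i: "i \<in> {1..k}" and n: "n > 0" and \<epsilon>: "\<epsilon> > 0"
    and \<phi> [measurable]: "\<phi> \<in> borel_measurable mu"
    and bound: "\<And>v. v \<in> space mu \<Longrightarrow> \<bar>\<phi> v\<bar> \<le> (1 :: real)"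
  defines "M \<equiv> sbm_space mu k n"
  shows "measure M {\<omega>\<in>space M. \<bar>(\<Sum>l\<in>{1..n}. \<phi> (\<omega> (i, l))) - n * (\<integral>v. \<phi> v \<partial>mu)\<bar> \<ge> \<epsilon> * n}
    \<le> 2 * exp (- (\<epsilon>\<^sup>2 / 2) * n)"
proof -
  define I where "I = {1..k} \<times> {1..n}"
  have M: "M = (\<Pi>\<^sub>M il\<in>I. mu)" by (simp add: M_def sbm_space_def I_def)
  interpret M: prob_space M unfolding M by (rule prob_space_PiM) (rule mu)
  have "I \<noteq> {}" and sub: "{i} \<times> {1..n} \<subseteq> I" using i n by (auto simp: I_def)
  have indep: "M.indep_vars (\<lambda>_. borel) (\<lambda>il \<omega>. \<phi> (\<omega> il)) ({i} \<times> {1..n})"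
    using M.indep_vars_subset[OF indep_vars_PiM_components[OF mu \<open>I \<noteq> {}\<close>, folded M] sub]
    by (rule M.indep_vars_compose2) simp
  interpret H: Hoeffding_ineq M "{i} \<times> {1..n}" "\<lambda>il \<omega>. \<phi> (\<omega> il)" "\<lambda>_. - 1" "\<lambda>_. 1"
      "\<Sum>il\<in>{i} \<times> {1..n}. M.expectation (\<lambda>\<omega>. \<phi> (\<omega> il))"
  proof unfold_locales
    fix il assume "il \<in> {i} \<times> {1..n}"
    then have "il \<in> I" using sub by blast
    then show "AE \<omega> in M. \<phi> (\<omega> il) \<in> {- 1..1}"
      using bound by (intro AE_I2) (force simp: M space_PiM PiE_iff abs_le_iff)
  qed (simp_all add: indep[simplified])
  have exp: "M.expectation (\<lambda>\<omega>. \<phi> (\<omega> il)) = (\<integral>v. \<phi> v \<partial>mu)" if "il \<in> I" for il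
  proof -
    have "(\<integral>v. \<phi> v \<partial>mu) = (\<integral>v. \<phi> v \<partial>distr M mu (\<lambda>\<omega>. \<omega> il))"
      using that mu by (simp add: M distr_PiM_component[of I "\<lambda>_. mu"])
    also have "\<dots> = M.expectation (\<lambda>\<omega>. \<phi> (\<omega> il))"
      using that by (intro integral_distr) (auto simp: M)
    finally show ?thesis by simp
  qed
  have "(\<Sum>il\<in>{i} \<times> {1..n}. M.expectation (\<lambda>\<omega>. \<phi> (\<omega> il))) = (\<Sum>il\<in>{i} \<times> {1..n}. \<integral>v. \<phi> v \<partial>mu)"
    using sub by (intro sum.cong refl exp) blast
  then have mean: "(\<Sum>il\<in>{i} \<times> {1..n}. M.expectation (\<lambda>\<omega>. \<phi> (\<omega> il))) = n * (\<integral>v. \<phi> v \<partial>mu)"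
    by simp
  have sum: "(\<Sum>il\<in>{i} \<times> {1..n}. \<phi> (\<omega> il)) = (\<Sum>l\<in>{1..n}. \<phi> (\<omega> (i, l)))" for \<omega>
  proof -
    have "{i} \<times> {1..n} = Pair i ` {1..n}" by auto
    then show ?thesis by (simp add: sum.reindex inj_on_def)
  qed
  \<comment> \<open>Hoeffding's exponent for \<open>n\<close> variables with range of width
    2.\<close>
  have eq: "- 2 * (\<epsilon> * n)\<^sup>2 / (\<Sum>il\<in>{i} \<times> {1..n}. (1 - (- 1 :: real))\<^sup>2) = - (\<epsilon>\<^sup>2 / 2) * n"
    using n by (simp add: power2_eq_square)
  have "\<epsilon> * n \<ge> 0" "(\<Sum>il\<in>{i} \<times> {1..n}. (1 - (- 1 :: real))\<^sup>2) > 0"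
    using \<epsilon> n by simp_all
  then show ?thesis
    using H.Hoeffding_ineq_abs_ge[of "\<epsilon> * n"] unfolding mean sum eq by blast
qed

text \<open>A union bound: the number of pairs of a ball and a test function is fixed, while each
  failure probability decays exponentially in \<open>n\<close>.\<close>

lemma sbm_uniform_law_of_large_numbers:
  fixes \<epsilon> \<delta> :: real
  assumes mu: "prob_space mu" and \<Phi>: "finite \<Phi>" and \<epsilon>: "\<epsilon> > 0" and \<delta>: "\<delta> > 0"
    and meas: "\<And>\<phi>. \<phi> \<in> \<Phi> \<Longrightarrow> \<phi> \<in> borel_measurable mu"
    and bound: "\<And>\<phi> v. \<phi> \<in> \<Phi> \<Longrightarrow> v \<in> space mu \<Longrightarrow> \<bar>\<phi> v\<bar> \<le> (1 :: real)"
  shows "\<exists>N>0. \<forall>n>N. {\<omega>\<in>space (sbm_space mu k n). \<forall>i\<in>{1..k}. \<forall>\<phi>\<in>\<Phi>.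
      \<bar>(\<Sum>l\<in>{1..n}. \<phi> (\<omega> (i, l))) - n * (\<integral>v. \<phi> v \<partial>mu)\<bar> < \<epsilon> * n} \<in> sets (sbm_space mu k n) \<and>
    measure (sbm_space mu k n) {\<omega>\<in>space (sbm_space mu k n). \<forall>i\<in>{1..k}. \<forall>\<phi>\<in>\<Phi>.
      \<bar>(\<Sum>l\<in>{1..n}. \<phi> (\<omega> (i, l))) - n * (\<integral>v. \<phi> v \<partial>mu)\<bar> < \<epsilon> * n} > 1 - \<delta>"
proof -
  have "(\<lambda>n. real (k * card \<Phi>) * (2 * exp (- (\<epsilon>\<^sup>2 / 2) * real n))) \<longlonglongrightarrow> real (k * card \<Phi>) * (2 * 0)"
    using \<epsilon> by (intro tendsto_intros filterlim_compose[OF exp_at_bot] filterlim_tendsto_neg_mult_at_bot[OF tendsto_const]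
        filterlim_real_sequentially) auto
  then have "eventually (\<lambda>n. real (k * card \<Phi>) * (2 * exp (- (\<epsilon>\<^sup>2 / 2) * real n)) < \<delta>) sequentially"
    using \<delta> by (intro order_tendstoD) auto
  then obtain N where N: "\<And>n. n \<ge> N \<Longrightarrow> real (k * card \<Phi>) * (2 * exp (- (\<epsilon>\<^sup>2 / 2) * real n)) < \<delta>"
    unfolding eventually_sequentially by blast
  show ?thesis
  proof (intro exI[of _ "Suc N"] conjI allI impI)
    fix n assume "n > Suc N"
    then have n: "n > 0" "n \<ge> N" by auto
    define M where "M = sbm_space mu k n"
    interpret M: prob_space M unfolding M_def by (rule prob_space_sbm_space[OF mu])
    define bad where "bad = (\<lambda>(i, \<phi>). {\<omega>\<in>space M. \<bar>(\<Sum>l\<in>{1..n}. \<phi> (\<omega> (i, l))) - n * (\<integral>v. \<phi> v \<partial>mu)\<bar> \<ge> \<epsilon> * n})"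
    let ?G = "{\<omega>\<in>space M. \<forall>i\<in>{1..k}. \<forall>\<phi>\<in>\<Phi>. \<bar>(\<Sum>l\<in>{1..n}. \<phi> (\<omega> (i, l))) - n * (\<integral>v. \<phi> v \<partial>mu)\<bar> < \<epsilon> * n}"
    have comp: "(\<lambda>\<omega>. \<phi> (\<omega> (i, l))) \<in> borel_measurable M"
      if "i \<in> {1..k}" "\<phi> \<in> \<Phi>" "l \<in> {1..n}" for i \<phi> l
    proof -
      have "(\<lambda>\<omega>. \<omega> (i, l)) \<in> measurable M mu"
        unfolding M_def sbm_space_def using that by (intro measurable_component_singleton) auto
      then show ?thesis using meas[OF that(2)] by (rule measurable_compose)
    qed
    have bad_sets: "bad p \<in> sets M" if "p \<in> {1..k} \<times> \<Phi>" for p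
      using that comp unfolding bad_def by (auto intro!: borel_measurable_le borel_measurable_abs borel_measurable_diff borel_measurable_sum)
    have G: "?G = space M - (\<Union>p\<in>{1..k} \<times> \<Phi>. bad p)"
      by (auto simp: bad_def simp flip: not_less)
    have fin: "finite ({1..k} \<times> \<Phi>)" using \<Phi> by simp
    have U_sets: "(\<Union>p\<in>{1..k} \<times> \<Phi>. bad p) \<in> sets M"
      using bad_sets fin by (intro sets.finite_UN) auto
    then show "?G \<in> sets M" unfolding G by auto
    have "M.prob (\<Union>p\<in>{1..k} \<times> \<Phi>. bad p) \<le> (\<Sum>p\<in>{1..k} \<times> \<Phi>. M.prob (bad p))"
      using bad_sets fin by (intro M.finite_measure_subadditive_finite) auto
    also have "\<dots> \<le> (\<Sum>p\<in>{1..k} \<times> \<Phi>. 2 * exp (- (\<epsilon>\<^sup>2 / 2) * n))"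
    proof (intro sum_mono)
      fix p assume p: "p \<in> {1..k} \<times> \<Phi>"
      obtain i \<phi> where [simp]: "p = (i, \<phi>)" by (cases p)
      show "M.prob (bad p) \<le> 2 * exp (- (\<epsilon>\<^sup>2 / 2) * n)"
        unfolding bad_def M_def \<open>p = (i, \<phi>)\<close> prod.case
        using p by (intro sbm_concentration[OF mu _ n(1) \<epsilon>] meas bound) auto
    qed
    also have "\<dots> = real (k * card \<Phi>) * (2 * exp (- (\<epsilon>\<^sup>2 / 2) * real n))"
      by (simp add: card_cartesian_product)
    also have "\<dots> < \<delta>" using N[OF n(2)] .
    finally show "M.prob ?G > 1 - \<delta>"
      unfolding G using M.prob_compl[OF U_sets] by linarith
  qed simp
qed

text \<open>Two different coordinates have joint law mu times mu. By Fubini it suffices to fix the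
  first one, and then the equation excludes a single value of the second, which is no atom.
  Independence is first obtained for the restrictions to the blocks \<open>{\<alpha>}\<close> and
  \<open>{\<beta>}\<close> and then composed with evaluation.\<close>

lemma AE_PiM_pair_neq:
  fixes mu :: "'a::euclidean_space measure"
  assumes mu: "prob_space mu" and id: "(\<lambda>v. v) \<in> borel_measurable mu"
    and no_atoms: "\<And>x. emeasure mu {x} = 0" and sing: "\<And>x. x \<in> space mu \<Longrightarrow> {x} \<in> sets mu"
    and \<alpha>: "\<alpha> \<in> I" and \<beta>: "\<beta> \<in> I" and "\<alpha> \<noteq> \<beta>"
  shows "AE \<omega> in (\<Pi>\<^sub>M i\<in>I. mu). a + \<omega> \<alpha> \<noteq> b + \<omega> \<beta>"
proof -
  define M where "M = (\<Pi>\<^sub>M i\<in>I. mu)"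
  interpret M: prob_space M unfolding M_def by (rule prob_space_PiM) (rule mu)
  interpret mu: prob_space mu by (rule mu)
  interpret pair_sigma_finite mu mu ..
  note id [measurable]
  have [measurable]: "(\<lambda>\<omega>. \<omega> \<alpha>) \<in> measurable M mu" "(\<lambda>\<omega>. \<omega> \<beta>) \<in> measurable M mu"
    unfolding M_def using \<alpha> \<beta> by (auto intro: measurable_component_singleton)
  have "M.indep_vars (\<lambda>_. mu) (\<lambda>i \<omega>. \<omega> i) I"
    unfolding M_def using \<alpha> by (intro indep_vars_PiM_components[OF mu]) auto
  then have "M.indep_var (PiM {\<alpha>} (\<lambda>_. mu)) (\<lambda>\<omega>. restrict (\<lambda>i. \<omega> i) {\<alpha>})
      (PiM {\<beta>} (\<lambda>_. mu)) (\<lambda>\<omega>. restrict (\<lambda>i. \<omega> i) {\<beta>})"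
    using \<alpha> \<beta> \<open>\<alpha> \<noteq> \<beta>\<close> by (intro M.indep_var_restrict) auto
  then have "M.indep_var mu ((\<lambda>f. f \<alpha>) \<circ> (\<lambda>\<omega>. restrict (\<lambda>i. \<omega> i) {\<alpha>}))
      mu ((\<lambda>f. f \<beta>) \<circ> (\<lambda>\<omega>. restrict (\<lambda>i. \<omega> i) {\<beta>}))"
    by (rule M.indep_var_compose) (auto intro: measurable_component_singleton)
  then have "M.indep_var mu (\<lambda>\<omega>. \<omega> \<alpha>) mu (\<lambda>\<omega>. \<omega> \<beta>)" by (simp add: comp_def)
  then have "distr M mu (\<lambda>\<omega>. \<omega> \<alpha>) \<Otimes>\<^sub>M distr M mu (\<lambda>\<omega>. \<omega> \<beta>)
      = distr M (mu \<Otimes>\<^sub>M mu) (\<lambda>\<omega>. (\<omega> \<alpha>, \<omega> \<beta>))"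
    unfolding M.indep_var_distribution_eq by blast
  then have pair: "distr M (mu \<Otimes>\<^sub>M mu) (\<lambda>\<omega>. (\<omega> \<alpha>, \<omega> \<beta>)) = mu \<Otimes>\<^sub>M mu"
    using mu \<alpha> \<beta> by (simp add: M_def distr_PiM_component[of I "\<lambda>_. mu"])
  have "AE p in mu \<Otimes>\<^sub>M mu. a + fst p \<noteq> b + snd p"
  proof (rule AE_pair_measure)
    show "{p\<in>space (mu \<Otimes>\<^sub>M mu). a + fst p \<noteq> b + snd p} \<in> sets (mu \<Otimes>\<^sub>M mu)" by measurable
    have "AE y in mu. a + x \<noteq> b + y" for x
    proof (rule AE_I')
      show "{a + x - b} \<inter> space mu \<in> null_sets mu"
      proof (cases "a + x - b \<in> space mu")
        case True
        then show ?thesis using no_atoms sing by (auto simp: null_sets_def)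
      qed simp
    qed (auto simp: algebra_simps)
    then show "AE x in mu. AE y in mu. a + fst (x, y) \<noteq> b + snd (x, y)" by simp
  qed
  then have "AE p in distr M (mu \<Otimes>\<^sub>M mu) (\<lambda>\<omega>. (\<omega> \<alpha>, \<omega> \<beta>)). a + fst p \<noteq> b + snd p"
    unfolding pair .
  then have "AE \<omega> in M. a + fst (\<omega> \<alpha>, \<omega> \<beta>) \<noteq> b + snd (\<omega> \<alpha>, \<omega> \<beta>)"
    by (rule AE_distrD[rotated]) measurable
  then show ?thesis unfolding M_def fst_conv snd_conv .
qed

lemma AE_sbm_points_distinct:
  fixes mu :: "(real ^ 'm) measure"
  assumes mu: "prob_space mu" and id: "(\<lambda>v. v) \<in> borel_measurable mu"
    and no_atoms: "\<And>x. emeasure mu {x} = 0" and sing: "\<And>x. x \<in> space mu \<Longrightarrow> {x} \<in> sets mu"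
  shows "AE \<omega> in sbm_space mu k n. inj_on (\<lambda>(i, l). c i + \<omega> (i, l)) ({1..k} \<times> {1..n})"
proof -
  define I where "I = {1..k} \<times> {1..n}"
  have "AE \<omega> in sbm_space mu k n. \<forall>p\<in>(I \<times> I) - Id. c (fst (fst p)) + \<omega> (fst p) \<noteq> c (fst (snd p)) + \<omega> (snd p)"
  proof (rule AE_finite_allI)
    show "finite ((I \<times> I) - Id)" by (simp add: I_def)
    fix p assume "p \<in> (I \<times> I) - Id"
    then have "fst p \<in> I" "snd p \<in> I" "fst p \<noteq> snd p" by auto
    then show "AE \<omega> in sbm_space mu k n. c (fst (fst p)) + \<omega> (fst p) \<noteq> c (fst (snd p)) + \<omega> (snd p)"
      unfolding sbm_space_def I_def by (intro AE_PiM_pair_neq[OF mu id no_atoms sing])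
  qed
  then show ?thesis
  proof eventually_elim
    case (elim \<omega>)
    then have "p = q" if "p \<in> I" "q \<in> I" "c (fst p) + \<omega> p = c (fst q) + \<omega> q" for p q
      using that by (metis (no_types, lifting) DiffI IdE SigmaI fst_conv snd_conv)
    then show ?case by (auto simp: inj_on_def I_def)
  qed
qed

section \<open>Measurability of exact recovery\<close>

text \<open>The linear program over an index set with an arbitrary cost matrix \<open>d\<close>. The
  feasible solutions then no longer depend on the sample; only the matrix does.\<close>

definition idx_cost :: "'i set \<Rightarrow> ('i \<Rightarrow> 'i \<Rightarrow> real) \<Rightarrow> ('i \<Rightarrow> 'i \<Rightarrow> real) \<Rightarrow> real" where
  "idx_cost J d z = (\<Sum>p\<in>J. \<Sum>q\<in>J. d p q * z p q)"

definition agree_on :: "'i set \<Rightarrow> ('i \<Rightarrow> real) \<times> ('i \<Rightarrow> 'i \<Rightarrow> real) \<Rightarrow> ('i \<Rightarrow> real) \<times> ('i \<Rightarrow> 'i \<Rightarrow> real) \<Rightarrow> bool" where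
  "agree_on J u v \<longleftrightarrow> (\<forall>p\<in>J. fst u p = fst v p) \<and> (\<forall>p\<in>J. \<forall>q\<in>J. snd u p q = snd v p q)"

text \<open>Optimality and uniqueness merged into one strict inequality, the form that can be tested
  on compact sets.\<close>

definition idx_unique ::
  "'i set \<Rightarrow> nat \<Rightarrow> ('i \<Rightarrow> 'i \<Rightarrow> real) \<Rightarrow> ('i \<Rightarrow> real) \<times> ('i \<Rightarrow> 'i \<Rightarrow> real) \<Rightarrow> bool" where
  "idx_unique J k d u \<longleftrightarrow> lp_feasible J k (fst u) (snd u) \<and>
     (\<forall>v. lp_feasible J k (fst v) (snd v) \<longrightarrow> idx_cost J d (snd u) < idx_cost J d (snd v) \<or> agree_on J v u)"

lemma agree_onD:
  assumes "agree_on J u v"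
  shows "lp_feasible J k (fst u) (snd u) \<longleftrightarrow> lp_feasible J k (fst v) (snd v)"
    and "ip_feasible J k (fst u) (snd u) \<longleftrightarrow> ip_feasible J k (fst v) (snd v)"
    and "idx_cost J d (snd u) = idx_cost J d (snd v)"
proof -
  have "(\<Sum>p\<in>J. snd u p q) = (\<Sum>p\<in>J. snd v p q)" if "q \<in> J" for q
    using assms that by (intro sum.cong) (auto simp: agree_on_def)
  moreover have "(\<Sum>p\<in>J. fst u p) = (\<Sum>p\<in>J. fst v p)"
    using assms by (intro sum.cong) (auto simp: agree_on_def)
  ultimately show "lp_feasible J k (fst u) (snd u) \<longleftrightarrow> lp_feasible J k (fst v) (snd v)"
    "ip_feasible J k (fst u) (snd u) \<longleftrightarrow> ip_feasible J k (fst v) (snd v)"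
    using assms by (simp_all add: lp_feasible_def ip_feasible_def agree_on_def)
  show "idx_cost J d (snd u) = idx_cost J d (snd v)"
    unfolding idx_cost_def using assms by (intro sum.cong) (auto simp: agree_on_def)
qed

lemma lp_unique_optimal_iff:
  "lp_unique_optimal P k y z \<longleftrightarrow> idx_unique P k dist (y, z)"
proof
  assume L: "lp_unique_optimal P k y z"
  then have opt: "lp_optimal P k y z" by (simp add: lp_unique_optimal_def)
  show "idx_unique P k dist (y, z)"
    unfolding idx_unique_def
  proof (intro conjI allI impI)
    show "lp_feasible P k (fst (y, z)) (snd (y, z))" using opt by (simp add: lp_optimal_def)
    fix v :: "('a \<Rightarrow> real) \<times> ('a \<Rightarrow> 'a \<Rightarrow> real)"
    assume v: "lp_feasible P k (fst v) (snd v)"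
    show "idx_cost P dist (snd (y, z)) < idx_cost P dist (snd v) \<or> agree_on P v (y, z)"
    proof (cases "lp_cost P (snd v) \<le> lp_cost P z")
      case True
      then have "lp_optimal P k (fst v) (snd v)"
        using opt v unfolding lp_optimal_def by (meson order_trans)
      then show ?thesis using L by (simp add: lp_unique_optimal_def agree_on_def)
    qed (simp add: idx_cost_def lp_cost_def)
  qed
next
  assume R: "idx_unique P k dist (y, z)"
  have feas: "lp_feasible P k y z" using R by (simp add: idx_unique_def)
  have alt: "lp_cost P z < lp_cost P z' \<or> agree_on P (y', z') (y, z)" if "lp_feasible P k y' z'" for y' z'
  proof -
    have "lp_feasible P k (fst (y', z')) (snd (y', z'))" using that by simp
    then have "idx_cost P dist (snd (y, z)) < idx_cost P dist (snd (y', z')) \<or> agree_on P (y', z') (y, z)"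
      using R unfolding idx_unique_def by blast
    then show ?thesis by (simp add: idx_cost_def lp_cost_def)
  qed
  have "lp_cost P z \<le> lp_cost P z'" if "lp_feasible P k y' z'" for y' z'
    using alt[OF that] agree_onD(3)[of P "(y', z')" "(y, z)" dist]
    by (auto simp: idx_cost_def lp_cost_def)
  then have "lp_optimal P k y z" using feas by (simp add: lp_optimal_def)
  moreover have "agree_on P (y', z') (y, z)" if "lp_optimal P k y' z'" for y' z'
    using that alt[of y' z'] feas unfolding lp_optimal_def by (auto simp: not_less[symmetric])
  ultimately show "lp_unique_optimal P k y z"
    by (simp add: lp_unique_optimal_def agree_on_def)
qed

section \<open>Passing from points to indices\<close>

definition pull :: "('i \<Rightarrow> 'a) \<Rightarrow> ('a \<Rightarrow> real) \<times> ('a \<Rightarrow> 'a \<Rightarrow> real) \<Rightarrow> ('i \<Rightarrow> real) \<times> ('i \<Rightarrow> 'i \<Rightarrow> real)" where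
  "pull x u = (\<lambda>p. fst u (x p), \<lambda>p q. snd u (x p) (x q))"

lemma pull_reindex:
  assumes "inj_on x J"
  shows "lp_feasible J k (fst (pull x u)) (snd (pull x u)) \<longleftrightarrow> lp_feasible (x ` J) k (fst u) (snd u)"
    and "ip_feasible J k (fst (pull x u)) (snd (pull x u)) \<longleftrightarrow> ip_feasible (x ` J) k (fst u) (snd u)"
    and "idx_cost J (\<lambda>p q. d (x p) (x q)) (snd (pull x u)) = idx_cost (x ` J) d (snd u)"
    and "agree_on J (pull x u) (pull x v) \<longleftrightarrow> agree_on (x ` J) u v"
  using assms by (simp_all add: lp_feasible_def ip_feasible_def idx_cost_def agree_on_def pull_def sum.reindex)

text \<open>Up to agreement on \<open>J\<close>, every solution on indices is thus pulled back from
  one on points, so no competitor is lost in the passage.\<close>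

lemma pull_inv_into:
  assumes "inj_on x J"
  shows "agree_on J (pull x (pull (inv_into J x) w)) w"
  using assms by (simp add: agree_on_def pull_def)

lemma agree_on_sym: "agree_on J u v \<longleftrightarrow> agree_on J v u"
  by (auto simp: agree_on_def)

lemma agree_on_trans: "agree_on J u v \<Longrightarrow> agree_on J v w \<Longrightarrow> agree_on J u w"
  by (auto simp: agree_on_def)

lemma idx_uniqueD:
  assumes "idx_unique J k d u" "lp_feasible J k (fst v) (snd v)"
  shows "idx_cost J d (snd u) < idx_cost J d (snd v) \<or> agree_on J v u"
  using assms unfolding idx_unique_def by blast

lemma idx_unique_agree:
  assumes uv: "agree_on J u v" and u: "idx_unique J k d u"
  shows "idx_unique J k d v"
  unfolding idx_unique_def
proof (intro conjI allI impI)
  show "lp_feasible J k (fst v) (snd v)"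
    using u agree_onD(1)[OF uv] unfolding idx_unique_def by blast
  fix w assume "lp_feasible J k (fst w) (snd w)"
  from idx_uniqueD[OF u this] show "idx_cost J d (snd v) < idx_cost J d (snd w) \<or> agree_on J w v"
    unfolding agree_onD(3)[OF uv] using agree_on_trans[OF _ uv] by blast
qed

lemma idx_unique_pull:
  assumes inj: "inj_on x J"
  shows "idx_unique J k (\<lambda>p q. d (x p) (x q)) (pull x u) \<longleftrightarrow> idx_unique (x ` J) k d u"
    (is "?L \<longleftrightarrow> ?R")
proof
  assume L: ?L
  show ?R
    unfolding idx_unique_def
  proof (intro conjI allI impI)
    show "lp_feasible (x ` J) k (fst u) (snd u)"
      using L unfolding idx_unique_def pull_reindex(1)[OF inj] by blast
    fix v assume "lp_feasible (x ` J) k (fst v) (snd v)"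
    then have "lp_feasible J k (fst (pull x v)) (snd (pull x v))"
      unfolding pull_reindex(1)[OF inj] .
    from idx_uniqueD[OF L this] show "idx_cost (x ` J) d (snd u) < idx_cost (x ` J) d (snd v) \<or> agree_on (x ` J) v u"
      unfolding pull_reindex(3,4)[OF inj] .
  qed
next
  assume R: ?R
  show ?L
    unfolding idx_unique_def
  proof (intro conjI allI impI)
    show "lp_feasible J k (fst (pull x u)) (snd (pull x u))"
      using R pull_reindex(1)[OF inj] by (simp add: idx_unique_def)
    fix w assume w: "lp_feasible J k (fst w) (snd w)"
    define v where "v = pull (inv_into J x) w"
    have v: "agree_on J (pull x v) w" unfolding v_def by (rule pull_inv_into[OF inj])
    then have "lp_feasible (x ` J) k (fst v) (snd v)"
      using w agree_onD(1)[OF v] pull_reindex(1)[OF inj] by blast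
    from idx_uniqueD[OF R this] have "idx_cost J (\<lambda>p q. d (x p) (x q)) (snd (pull x u))
        < idx_cost J (\<lambda>p q. d (x p) (x q)) (snd (pull x v)) \<or> agree_on J (pull x v) (pull x u)"
      unfolding pull_reindex(3,4)[OF inj] .
    then show "idx_cost J (\<lambda>p q. d (x p) (x q)) (snd (pull x u)) < idx_cost J (\<lambda>p q. d (x p) (x q)) (snd w)
        \<or> agree_on J w (pull x u)"
      unfolding agree_onD(3)[OF v] using agree_on_trans[of J w "pull x v"] v agree_on_sym[of J w] by blast
  qed
qed

text \<open>Coding 0/1 solutions by sets turns the search for an integral solution into a finite
  disjunction.\<close>

definition indicator_sol :: "'i set \<Rightarrow> ('i \<times> 'i) set \<Rightarrow> ('i \<Rightarrow> real) \<times> ('i \<Rightarrow> 'i \<Rightarrow> real)" where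
  "indicator_sol Y Z = (indicator Y, \<lambda>p q. indicator Z (p, q))"

text \<open>Integrality forces the values on the sample to be 0 or 1, so a recovering solution
  agrees there with the code of its sets of ones, and agreement is all that the conditions see. The
  quantifier over functions becomes one over finitely many sets when \<open>J\<close> is
  finite.\<close>

lemma exact_recovery_indexed:
  fixes x :: "'i \<Rightarrow> 'a::metric_space"
  assumes inj: "inj_on x J" and P: "(\<Union>i\<in>{1..k}. C i) = x ` J"
  shows "exact_recovery k C \<longleftrightarrow> (\<exists>Y\<in>Pow J. \<exists>Z\<in>Pow (J \<times> J).
      idx_unique J k (\<lambda>p q. dist (x p) (x q)) (indicator_sol Y Z) \<and>
      ip_feasible J k (fst (indicator_sol Y Z)) (snd (indicator_sol Y Z)) \<and>
      (\<forall>i\<in>{1..k}. \<exists>p\<in>Y. x p \<in> C i \<and> (\<forall>q\<in>Y. x q \<in> C i \<longrightarrow> q = p)) \<and>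
      (\<forall>pq\<in>Z. \<exists>i\<in>{1..k}. x (fst pq) \<in> C i \<and> x (snd pq) \<in> C i))"
    (is "?L \<longleftrightarrow> (\<exists>Y\<in>_. \<exists>Z\<in>_. ?R Y Z)")
proof -
  \<comment> \<open>All conditions transfer as soon as \<open>u\<close> and the code agree on
    \<open>J\<close>. The two directions below differ only in which of them is constructed from the
    other.\<close>
  have key: "(idx_unique (x ` J) k dist u \<and> ip_feasible (x ` J) k (fst u) (snd u) \<and>
        (\<forall>i\<in>{1..k}. \<exists>!a. a \<in> C i \<and> fst u a = 1) \<and>
        (\<forall>a\<in>x ` J. \<forall>b\<in>x ` J. snd u a b = 1 \<longrightarrow> (\<exists>i\<in>{1..k}. a \<in> C i \<and> b \<in> C i))) \<longleftrightarrow> ?R Y Z"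
    if agree: "agree_on J (pull x u) (indicator_sol Y Z)" and Y: "Y \<subseteq> J" and Z: "Z \<subseteq> J \<times> J" for u Y Z
  proof -
    have 1: "idx_unique (x ` J) k dist u \<longleftrightarrow> idx_unique J k (\<lambda>p q. dist (x p) (x q)) (indicator_sol Y Z)"
      using idx_unique_pull[OF inj, of k dist u] idx_unique_agree[OF agree]
        idx_unique_agree[OF agree[unfolded agree_on_sym[of J "pull x u"]]] by blast
    have 2: "ip_feasible (x ` J) k (fst u) (snd u) \<longleftrightarrow>
        ip_feasible J k (fst (indicator_sol Y Z)) (snd (indicator_sol Y Z))"
      using pull_reindex(2)[OF inj, of k u] agree_onD(2)[OF agree, of k] by blast
    have uY: "fst u (x p) = 1 \<longleftrightarrow> p \<in> Y" if "p \<in> J" for p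
      using agree that by (auto simp: agree_on_def pull_def indicator_sol_def indicator_def)
    have uZ: "snd u (x p) (x q) = 1 \<longleftrightarrow> (p, q) \<in> Z" if "p \<in> J" "q \<in> J" for p q
      using agree that by (auto simp: agree_on_def pull_def indicator_sol_def indicator_def)
    have C: "a \<in> C i \<Longrightarrow> i \<in> {1..k} \<Longrightarrow> \<exists>p\<in>J. a = x p" for a i using P by blast
    have 3: "(\<exists>!a. a \<in> C i \<and> fst u a = 1) \<longleftrightarrow> (\<exists>p\<in>Y. x p \<in> C i \<and> (\<forall>q\<in>Y. x q \<in> C i \<longrightarrow> q = p))"
      if i: "i \<in> {1..k}" for i
    proof
      assume "\<exists>!a. a \<in> C i \<and> fst u a = 1"
      then obtain a where a: "a \<in> C i" "fst u a = 1" "\<And>b. b \<in> C i \<Longrightarrow> fst u b = 1 \<Longrightarrow> b = a" by blast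
      obtain p where p: "p \<in> J" "a = x p" using C[OF a(1) i] by blast
      have "q = p" if "q \<in> Y" "x q \<in> C i" for q
      proof -
        have "x q = x p" using a(3)[of "x q"] uY[of q] that Y p(2) by blast
        then show ?thesis using inj_onD[OF inj] that Y p(1) by blast
      qed
      then show "\<exists>p\<in>Y. x p \<in> C i \<and> (\<forall>q\<in>Y. x q \<in> C i \<longrightarrow> q = p)"
        using a(1,2) p uY[OF p(1)] by blast
    next
      assume "\<exists>p\<in>Y. x p \<in> C i \<and> (\<forall>q\<in>Y. x q \<in> C i \<longrightarrow> q = p)"
      then obtain p where p: "p \<in> Y" "x p \<in> C i" "\<And>q. q \<in> Y \<Longrightarrow> x q \<in> C i \<Longrightarrow> q = p" by blast
      show "\<exists>!a. a \<in> C i \<and> fst u a = 1"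
      proof (rule ex1I)
        show "x p \<in> C i \<and> fst u (x p) = 1" using p Y uY by blast
        fix b assume b: "b \<in> C i \<and> fst u b = 1"
        then obtain q where q: "q \<in> J" "b = x q" using C i by blast
        then show "b = x p" using b uY[OF q(1)] p(3) by blast
      qed
    qed
    have 4: "(\<forall>a\<in>x ` J. \<forall>b\<in>x ` J. snd u a b = 1 \<longrightarrow> (\<exists>i\<in>{1..k}. a \<in> C i \<and> b \<in> C i)) \<longleftrightarrow>
        (\<forall>pq\<in>Z. \<exists>i\<in>{1..k}. x (fst pq) \<in> C i \<and> x (snd pq) \<in> C i)"
    proof -
      have "(\<forall>a\<in>x ` J. \<forall>b\<in>x ` J. snd u a b = 1 \<longrightarrow> (\<exists>i\<in>{1..k}. a \<in> C i \<and> b \<in> C i)) \<longleftrightarrow>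
          (\<forall>p\<in>J. \<forall>q\<in>J. (p, q) \<in> Z \<longrightarrow> (\<exists>i\<in>{1..k}. x p \<in> C i \<and> x q \<in> C i))"
        by (simp add: uZ)
      also have "\<dots> \<longleftrightarrow> (\<forall>pq\<in>Z. \<exists>i\<in>{1..k}. x (fst pq) \<in> C i \<and> x (snd pq) \<in> C i)"
        using Z by (auto 4 3)
      finally show ?thesis .
    qed
    show ?thesis using 1 2 3 4 by auto
  qed
  have "?L \<longleftrightarrow> (\<exists>u. idx_unique (x ` J) k dist u \<and> ip_feasible (x ` J) k (fst u) (snd u) \<and>
        (\<forall>i\<in>{1..k}. \<exists>!a. a \<in> C i \<and> fst u a = 1) \<and>
        (\<forall>a\<in>x ` J. \<forall>b\<in>x ` J. snd u a b = 1 \<longrightarrow> (\<exists>i\<in>{1..k}. a \<in> C i \<and> b \<in> C i)))" (is "_ \<longleftrightarrow> (\<exists>u. ?U u)")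
    unfolding exact_recovery_def Let_def P lp_unique_optimal_iff split_paired_Ex fst_conv snd_conv ..
  also have "\<dots> \<longleftrightarrow> (\<exists>Y\<in>Pow J. \<exists>Z\<in>Pow (J \<times> J). ?R Y Z)"
  proof
    assume "\<exists>u. ?U u"
    then obtain u where u: "?U u" ..
    define Y where "Y = {p\<in>J. fst u (x p) = 1}"
    define Z where "Z = {pq\<in>J \<times> J. snd u (x (fst pq)) (x (snd pq)) = 1}"
    have ip: "ip_feasible (x ` J) k (fst u) (snd u)" using u by blast
    have "fst u (x p) \<in> {0, 1}" if "p \<in> J" for p using ip that unfolding ip_feasible_def by blast
    moreover have "snd u (x p) (x q) \<in> {0, 1}" if "p \<in> J" "q \<in> J" for p q
      using ip that unfolding ip_feasible_def by blast
    ultimately have agree: "agree_on J (pull x u) (indicator_sol Y Z)"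
      by (fastforce simp: agree_on_def pull_def indicator_sol_def indicator_def Y_def Z_def)
    have YZ: "Y \<subseteq> J" "Z \<subseteq> J \<times> J" by (auto simp: Y_def Z_def)
    show "\<exists>Y\<in>Pow J. \<exists>Z\<in>Pow (J \<times> J). ?R Y Z"
      by (rule bexI, rule bexI, rule iffD1[OF key[OF agree YZ] u]) (use YZ in simp_all)
  next
    assume "\<exists>Y\<in>Pow J. \<exists>Z\<in>Pow (J \<times> J). ?R Y Z"
    then obtain Y Z where YZ: "Y \<subseteq> J" "Z \<subseteq> J \<times> J" "?R Y Z"
      by (elim bexE) (rule that, (rule PowD, assumption)+)
    from iffD2[OF key[OF pull_inv_into[OF inj] YZ(1,2)] YZ(3)] show "\<exists>u. ?U u" by (rule exI)
  qed
  finally show ?thesis .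
qed

section \<open>Compactness and the reduction to countably many conditions\<close>

type_synonym 'i sol = "('i \<Rightarrow> real) \<times> ('i \<Rightarrow> 'i \<Rightarrow> real)"

text \<open>The bounds are imposed at all arguments, not only on \<open>J\<close>, so that
  Tychonoff's theorem applies in the product topology.\<close>

definition sol_box :: "real \<Rightarrow> 'i sol set" where
  "sol_box B = {y. \<forall>p. y p \<in> {0..B}} \<times> {z. \<forall>p q. z p q \<in> {0..B}}"

lemma compact_all_in:
  fixes S :: "'i \<Rightarrow> 'a::topological_space set"
  assumes "\<And>i. compact (S i)"
  shows "compact {y. \<forall>i. y i \<in> S i}"
proof -
  have "{y. \<forall>i. y i \<in> S i} = PiE UNIV S" by (auto simp: PiE_def)
  moreover have "compactin (product_topology (\<lambda>_. euclidean) UNIV) (PiE UNIV S)"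
    unfolding compactin_PiE using assms by simp
  ultimately show ?thesis by (simp add: euclidean_product_topology)
qed

lemma compact_sol_box: "compact (sol_box B :: 'i sol set)"
proof -
  have y: "compact {y :: 'i \<Rightarrow> real. \<forall>p. y p \<in> {0..B}}"
    by (rule compact_all_in) (rule compact_Icc)
  have "compact {z :: 'i \<Rightarrow> 'i \<Rightarrow> real. \<forall>p. z p \<in> {w. \<forall>q. w q \<in> {0..B}}}"
    using y by (rule compact_all_in)
  then have "compact {z :: 'i \<Rightarrow> 'i \<Rightarrow> real. \<forall>p q. z p q \<in> {0..B}}"
    unfolding mem_Collect_eq .
  with y show ?thesis
    unfolding sol_box_def by (rule compact_Times)
qed

lemma continuous_on_fst_coord: "continuous_on S (\<lambda>u :: 'i sol. fst u p)"
  by (rule continuous_on_product_then_coordinatewise) (rule continuous_on_fst[OF continuous_on_id])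

lemma continuous_on_snd_coord: "continuous_on S (\<lambda>u :: 'i sol. snd u p q)"
  by (rule continuous_on_product_then_coordinatewise, rule continuous_on_product_then_coordinatewise)
    (rule continuous_on_snd[OF continuous_on_id])

lemmas continuous_on_coords = continuous_on_fst_coord continuous_on_snd_coord

lemma closed_Collect_ball: "(\<And>a. a \<in> A \<Longrightarrow> closed {u. Q u a}) \<Longrightarrow> closed {u. \<forall>a\<in>A. Q u a}"
  unfolding Collect_ball_eq by (rule closed_INT) blast

lemma closed_feasible: "closed {u :: 'i sol. lp_feasible J k (fst u) (snd u)}"
  unfolding lp_feasible_def
  by (intro closed_Collect_conj closed_Collect_ball closed_Collect_eq closed_Collect_le
      continuous_intros continuous_on_coords)

definition sol_gap :: "'i set \<Rightarrow> 'i sol \<Rightarrow> 'i sol \<Rightarrow> real" where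
  "sol_gap J u v = (\<Sum>p\<in>J. \<bar>fst u p - fst v p\<bar>) + (\<Sum>p\<in>J. \<Sum>q\<in>J. \<bar>snd u p q - snd v p q\<bar>)"

lemma sol_gap_nonneg: "sol_gap J u v \<ge> 0"
  unfolding sol_gap_def by (intro add_nonneg_nonneg sum_nonneg) auto

lemma sol_gap_eq_0_iff:
  assumes "finite J"
  shows "sol_gap J u v = 0 \<longleftrightarrow> agree_on J u v"
  unfolding sol_gap_def agree_on_def using assms
  by (subst add_nonneg_eq_0_iff) (auto simp: sum_nonneg sum_nonneg_eq_0_iff)

text \<open>A positive continuous function on a compact set has a positive minimum, hence a bound of
  the form 1/(j+1). Unlike strict positivity, this weak inequality is a closed condition and passes
  from \<open>D\<close> to its closure.\<close>

lemma pos_on_compact_iff: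
  fixes f :: "'a::topological_space \<Rightarrow> real"
  assumes K: "compact K" and cont: "continuous_on UNIV f" and D: "D \<subseteq> K" "K \<subseteq> closure D"
  shows "(\<forall>u\<in>K. f u > 0) \<longleftrightarrow> (\<exists>j::nat. \<forall>u\<in>D. f u \<ge> 1 / Suc j)"
proof
  assume pos: "\<forall>u\<in>K. f u > 0"
  show "\<exists>j::nat. \<forall>u\<in>D. f u \<ge> 1 / Suc j"
  proof (cases "K = {}")
    case False
    then obtain w where w: "w \<in> K" "\<And>u. u \<in> K \<Longrightarrow> f w \<le> f u"
      using continuous_attains_inf[OF K _ continuous_on_subset[OF cont]] by blast
    then obtain j :: nat where "1 / Suc j < f w"
      using pos reals_Archimedean[of "f w"] by (auto simp: inverse_eq_divide)
    then show ?thesis using w D(1) by (meson less_imp_le order_trans subsetD)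
  qed (use D in auto)
next
  assume "\<exists>j::nat. \<forall>u\<in>D. f u \<ge> 1 / Suc j"
  then obtain j :: nat where j: "\<forall>u\<in>D. f u \<ge> 1 / Suc j" ..
  have "closed {u. 1 / Suc j \<le> f u}"
    by (intro closed_Collect_le continuous_on_const cont)
  then have "closure D \<subseteq> {u. 1 / Suc j \<le> f u}"
    using j by (intro closure_minimal) auto
  then have "1 / Suc j \<le> f u" if "u \<in> K" for u using that D(2) by blast
  then show "\<forall>u\<in>K. f u > 0" by (smt (verit) of_nat_0_less_iff zero_less_Suc zero_less_divide_1_iff)
qed

text \<open>The cost gap is zero at \<open>u\<close> itself, so a neighbourhood of \<open>u\<close>
  is cut out to keep the set compact. The box size \<open>real k + 1\<close> dominates both bounds,
  \<open>k\<close> for opening values and 1 for assignments.\<close>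

definition far_solutions :: "'i set \<Rightarrow> nat \<Rightarrow> 'i sol \<Rightarrow> nat \<Rightarrow> 'i sol set" where
  "far_solutions J k u m = sol_box (real k + 1) \<inter>
     {v. lp_feasible J k (fst v) (snd v) \<and> 1 / Suc m \<le> sol_gap J v u}"

lemma compact_far_solutions: "compact (far_solutions J k u m)"
proof -
  have "closed {v. 1 / Suc m \<le> sol_gap J v u}"
    unfolding sol_gap_def
    by (intro closed_Collect_le continuous_intros continuous_on_coords)
  then show ?thesis
    unfolding far_solutions_def
    by (intro compact_Int_closed compact_sol_box closed_Collect_conj closed_feasible)
qed

lemma idx_unique_iff_far:
  assumes J: "finite J"
  shows "idx_unique J k d u \<longleftrightarrow> lp_feasible J k (fst u) (snd u) \<and>
    (\<forall>m. \<forall>v\<in>far_solutions J k u m. idx_cost J d (snd v) - idx_cost J d (snd u) > 0)"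
proof
  assume L: "idx_unique J k d u"
  have "idx_cost J d (snd v) - idx_cost J d (snd u) > 0" if "v \<in> far_solutions J k u m" for m v
  proof -
    have "0 < sol_gap J v u"
      using that by (auto simp: far_solutions_def intro: less_le_trans[rotated])
    then have "\<not> agree_on J v u" using sol_gap_eq_0_iff[OF J] by (metis less_irrefl)
    moreover have "lp_feasible J k (fst v) (snd v)" using that by (simp add: far_solutions_def)
    ultimately show ?thesis using idx_uniqueD[OF L, of v] by simp
  qed
  then show "lp_feasible J k (fst u) (snd u) \<and>
      (\<forall>m. \<forall>v\<in>far_solutions J k u m. idx_cost J d (snd v) - idx_cost J d (snd u) > 0)"
    using L unfolding idx_unique_def by blast
next
  assume R: "lp_feasible J k (fst u) (snd u) \<and>
    (\<forall>m. \<forall>v\<in>far_solutions J k u m. idx_cost J d (snd v) - idx_cost J d (snd u) > 0)"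
  have "idx_cost J d (snd u) < idx_cost J d (snd v) \<or> agree_on J v u"
    if v: "lp_feasible J k (fst v) (snd v)" for v
  proof (cases "agree_on J v u")
    case False
    \<comment> \<open>Values of \<open>v\<close> outside \<open>J\<close> are unconstrained; they
      are set to 0 to move the solution into the box without changing its cost.\<close>
    define w :: "'a sol" where "w = (\<lambda>p. if p \<in> J then fst v p else 0,
      \<lambda>p q. if p \<in> J \<and> q \<in> J then snd v p q else 0)"
    have w: "agree_on J w v" by (simp add: w_def agree_on_def)
    have "fst v p \<le> real k" if "p \<in> J" for p
    proof -
      have "fst v p \<le> (\<Sum>p\<in>J. fst v p)"
        using v that J by (intro member_le_sum) (auto simp: lp_feasible_def)
      then show ?thesis using v by (simp add: lp_feasible_def)
    qed
    moreover have "snd v p q \<le> 1" if "p \<in> J" "q \<in> J" for p q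
    proof -
      have "snd v p q \<le> (\<Sum>p\<in>J. snd v p q)"
        using v that J by (intro member_le_sum) (auto simp: lp_feasible_def)
      then show ?thesis using v that by (simp add: lp_feasible_def)
    qed
    ultimately have "w \<in> sol_box (real k + 1)"
      using v by (fastforce simp: sol_box_def w_def lp_feasible_def)
    moreover have feas: "lp_feasible J k (fst w) (snd w)"
      using v agree_onD(1)[OF w] by blast
    moreover have "sol_gap J w u > 0"
    proof -
      have "\<not> agree_on J w u" using False w agree_on_trans agree_on_sym by metis
      then show ?thesis using sol_gap_eq_0_iff[OF J] sol_gap_nonneg by (metis order_less_le)
    qed
    then obtain m :: nat where "1 / Suc m < sol_gap J w u"
      using reals_Archimedean by (auto simp: inverse_eq_divide)
    ultimately have "w \<in> far_solutions J k u m" by (simp add: far_solutions_def)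
    then have "idx_cost J d (snd w) - idx_cost J d (snd u) > 0" using R by blast
    then show ?thesis unfolding agree_onD(3)[OF w] by simp
  qed simp
  then show "idx_unique J k d u" using R unfolding idx_unique_def by blast
qed

text \<open>The compact sets depend on \<open>u\<close> but not on the outcome, so the dense sets
  are chosen once and for all. Only the costs vary with the outcome, and they do so
  measurably.\<close>

lemma measurable_idx_unique:
  fixes X :: "'w \<Rightarrow> 'i::countable \<Rightarrow> 'a::euclidean_space"
  assumes J: "finite J" and X [measurable]: "\<And>i. (\<lambda>\<omega>. X \<omega> i) \<in> borel_measurable M"
  shows "{\<omega>\<in>space M. idx_unique J k (\<lambda>p q. dist (X \<omega> p) (X \<omega> q)) u} \<in> sets M"
proof -
  \<comment> \<open>Countability of the index type makes the space of solutions second countable, so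
    each of its subsets has a countable dense part.\<close>
  have "\<exists>D. countable D \<and> D \<subseteq> far_solutions J k u m \<and> far_solutions J k u m \<subseteq> closure D" for m
    by (metis separable)
  then obtain D where D: "\<And>m. countable (D m)" "\<And>m. D m \<subseteq> far_solutions J k u m"
      "\<And>m. far_solutions J k u m \<subseteq> closure (D m)"
    by metis
  define f where "f \<omega> v = idx_cost J (\<lambda>p q. dist (X \<omega> p) (X \<omega> q)) (snd v)
      - idx_cost J (\<lambda>p q. dist (X \<omega> p) (X \<omega> q)) (snd u)" for \<omega> and v :: "'i sol"
  have cont: "continuous_on UNIV (f \<omega>)" for \<omega>
    unfolding f_def idx_cost_def by (intro continuous_intros continuous_on_coords)
  have [measurable]: "(\<lambda>\<omega>. f \<omega> v) \<in> borel_measurable M" for v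
    unfolding f_def idx_cost_def by measurable
  have iff: "idx_unique J k (\<lambda>p q. dist (X \<omega> p) (X \<omega> q)) u \<longleftrightarrow>
      lp_feasible J k (fst u) (snd u) \<and> (\<forall>m. \<exists>j::nat. \<forall>v\<in>D m. 1 / Suc j \<le> f \<omega> v)" for \<omega>
    unfolding idx_unique_iff_far[OF J] f_def[symmetric]
      pos_on_compact_iff[OF compact_far_solutions cont D(2,3)] ..
  have "{\<omega>\<in>space M. \<forall>v\<in>D m. 1 / Suc j \<le> f \<omega> v} \<in> sets M" for m and j :: nat
    by (intro sets.sets_Collect_countable_All' D(1)) measurable
  then show ?thesis
    unfolding iff
    by (intro sets.sets_Collect_conj sets.sets_Collect_countable_All sets.sets_Collect_countable_Ex sets.sets_Collect_const)
qed

text \<open>Which sample points coincide depends on the outcome. For each candidate set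
  \<open>J\<close> of representatives the condition is measurable, there are finitely many
  candidates, and all valid ones give the same answer, so an existential quantifier over
  \<open>J\<close> is harmless.\<close>

lemma measurable_exact_recovery:
  fixes X :: "'w \<Rightarrow> 'i::countable \<Rightarrow> 'a::euclidean_space"
  assumes I: "finite (\<Union>i\<in>{1..k}. A i)" and X [measurable]: "\<And>i. (\<lambda>\<omega>. X \<omega> i) \<in> borel_measurable M"
  shows "{\<omega>\<in>space M. exact_recovery k (\<lambda>i. X \<omega> ` A i)} \<in> sets M"
proof -
  define I where "I = (\<Union>i\<in>{1..k}. A i)"
  have finI: "finite I" using I by (simp add: I_def)
  \<comment> \<open>The first two conjuncts say that \<open>J\<close> is a valid set of
    representatives. Membership in a cluster is written as an equation with one of its points,
    because such equations define measurable events.\<close>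
  define R where "R \<omega> J Y Z \<longleftrightarrow> (\<forall>p\<in>J. \<forall>q\<in>J. X \<omega> p = X \<omega> q \<longrightarrow> p = q) \<and>
      (\<forall>a\<in>I. \<exists>p\<in>J. X \<omega> a = X \<omega> p) \<and>
      idx_unique J k (\<lambda>p q. dist (X \<omega> p) (X \<omega> q)) (indicator_sol Y Z) \<and>
      ip_feasible J k (fst (indicator_sol Y Z)) (snd (indicator_sol Y Z)) \<and>
      (\<forall>i\<in>{1..k}. \<exists>p\<in>Y. (\<exists>a\<in>A i. X \<omega> p = X \<omega> a) \<and> (\<forall>q\<in>Y. (\<exists>a\<in>A i. X \<omega> q = X \<omega> a) \<longrightarrow> q = p)) \<and>
      (\<forall>pq\<in>Z. \<exists>i\<in>{1..k}. (\<exists>a\<in>A i. X \<omega> (fst pq) = X \<omega> a) \<and> (\<exists>a\<in>A i. X \<omega> (snd pq) = X \<omega> a))" for \<omega> J Y Z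
  have iff: "exact_recovery k (\<lambda>i. X \<omega> ` A i) \<longleftrightarrow>
      (\<exists>J\<in>Pow I. \<exists>Y\<in>Pow J. \<exists>Z\<in>Pow (J \<times> J). R \<omega> J Y Z)" for \<omega>
  proof -
    have rec: "exact_recovery k (\<lambda>i. X \<omega> ` A i) \<longleftrightarrow> (\<exists>Y\<in>Pow J. \<exists>Z\<in>Pow (J \<times> J). R \<omega> J Y Z)"
      if J: "J \<subseteq> I" "inj_on (X \<omega>) J" "X \<omega> ` J = X \<omega> ` I" for J
    proof -
      have eq: "(\<Union>i\<in>{1..k}. X \<omega> ` A i) = X \<omega> ` J" unfolding J(3) I_def by blast
      have "\<forall>p\<in>J. \<forall>q\<in>J. X \<omega> p = X \<omega> q \<longrightarrow> p = q" "\<forall>a\<in>I. \<exists>p\<in>J. X \<omega> a = X \<omega> p"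
        using J by (blast dest: inj_onD)+
      then show ?thesis
        unfolding exact_recovery_indexed[OF J(2) eq] R_def image_iff by simp
    qed
    show ?thesis
    proof
      assume L: "exact_recovery k (\<lambda>i. X \<omega> ` A i)"
      obtain J where J: "J \<subseteq> I" "inj_on (X \<omega>) J" "X \<omega> ` J = X \<omega> ` I"
        using subset_image_inj[of "X \<omega> ` I" "X \<omega>" I] by auto
      show "\<exists>J\<in>Pow I. \<exists>Y\<in>Pow J. \<exists>Z\<in>Pow (J \<times> J). R \<omega> J Y Z"
        by (rule bexI[of _ J], rule iffD1[OF rec[OF J] L], rule PowI[OF J(1)])
    next
      assume "\<exists>J\<in>Pow I. \<exists>Y\<in>Pow J. \<exists>Z\<in>Pow (J \<times> J). R \<omega> J Y Z"
      then obtain J Y Z where J: "J \<subseteq> I" "Y \<in> Pow J" "Z \<in> Pow (J \<times> J)" "R \<omega> J Y Z"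
        unfolding Pow_iff by blast
      note inj = J(4)[unfolded R_def, THEN conjunct1]
      note cover = J(4)[unfolded R_def, THEN conjunct2, THEN conjunct1]
      have "inj_on (X \<omega>) J" using inj by (intro inj_onI) blast
      moreover have "X \<omega> ` J = X \<omega> ` I" using cover J(1) by blast
      ultimately show "exact_recovery k (\<lambda>i. X \<omega> ` A i)"
        by (rule iffD2[OF rec[OF J(1)]])
          (rule bexI[of _ Y], rule bexI[of _ Z], rule J(4), rule J(3), rule J(2))
    qed
  qed
  have R: "{\<omega>\<in>space M. R \<omega> J Y Z} \<in> sets M" if "J \<subseteq> I" for J Y Z
  proof -
    have eq: "{\<omega>\<in>space M. X \<omega> p = X \<omega> q} \<in> sets M" for p q
      by measurable
    show ?thesis
      unfolding R_def
      by (intro sets.sets_Collect_conj sets.sets_Collect_imp sets.sets_Collect_countable_Ball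
          sets.sets_Collect_countable_Bex sets.sets_Collect_const eq measurable_idx_unique
          finite_subset[OF that finI] X)
  qed
  show ?thesis
    unfolding iff
  proof (intro sets.sets_Collect_finite_Ex)
    fix J Y Z assume "J \<in> Pow I"
    then show "{\<omega>\<in>space M. R \<omega> J Y Z} \<in> sets M" using R by blast
  qed (use finI in \<open>auto intro: finite_subset\<close>)
qed

section \<open>The counterexample\<close>

lemma Min_dist_line_center:
  "Min {dist (line_center i) (line_center j) |i j. i \<in> {1..7} \<and> j \<in> {1..7} \<and> i \<noteq> j} = 2 + 0.2"
    (is "Min ?S = _")
proof (rule Min_eqI)
  have "?S \<subseteq> (\<lambda>(i, j). dist (line_center i) (line_center j)) ` ({1..7} \<times> {1..7})" by auto
  then show "finite ?S" by (rule finite_subset) simp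
  fix x assume "x \<in> ?S"
  then obtain i j :: nat where ij: "i \<noteq> j" "x = 2.2 * \<bar>real i - real j\<bar>"
    by (auto simp: dist_line_center)
  then have "\<bar>real i - real j\<bar> \<ge> 1" by linarith
  then show "2 + 0.2 \<le> x" using ij(2) by simp
next
  have "dist (line_center 1) (line_center 2) = 2 + 0.2" by (simp add: dist_line_center)
  then show "2 + 0.2 \<in> ?S" by (intro CollectI exI[of _ 1] exI[of _ 2]) auto
qed

definition quarter_turn :: "real ^ 2 ^ 2" where
  "quarter_turn = vector [vector [0, - 1], vector [1, 0]]"

lemma quarter_turn_apply: "(quarter_turn *v v) $ 1 = - (v $ 2)" "(quarter_turn *v v) $ 2 = v $ 1"
  by (simp_all add: quarter_turn_def matrix_vector_mult_def sum_2)

lemma rotation_matrix_quarter_turn: "rotation_matrix quarter_turn"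
  unfolding rotation_matrix_def orthogonal_matrix_def
  by (simp add: quarter_turn_def det_2 vec_eq_iff forall_2 matrix_matrix_mult_def transpose_def sum_2 mat_def)

lemma borel_measurable_unit_ball_distribution:
  assumes "unit_ball_distribution mu" "f \<in> borel_measurable borel"
  shows "f \<in> borel_measurable mu"
proof -
  have sets: "sets mu = sets (restrict_space borel (cball 0 1))"
    using assms(1) by (simp add: unit_ball_distribution_def)
  show ?thesis
    unfolding measurable_cong_sets[OF sets refl] using assms(2) by (rule measurable_restrict_space1)
qed

text \<open>A quarter turn alone suffices: it gives E v1 = - E v2 and E v2 = E v1, so both vanish,
  and E v1^2 = E v2^2, so each is half of E |v|^2.\<close>

lemma rotation_invariant_moments:
  fixes mu :: "(real ^ 2) measure"
  assumes mu: "unit_ball_distribution mu" and rot: "rotation_invariant mu"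
  shows "(\<integral>v. v $ j \<partial>mu) = 0" and "(\<integral>v. (v $ j)\<^sup>2 \<partial>mu) = (\<integral>v. (norm v)\<^sup>2 \<partial>mu) / 2"
proof -
  interpret prob_space mu using mu by (simp add: unit_ball_distribution_def)
  have sets_mu: "sets mu = sets (restrict_space borel (cball 0 1))"
    using mu by (simp add: unit_ball_distribution_def)
  have space_mu: "space mu = cball 0 1"
    using sets_eq_imp_space_eq[OF sets_mu] by (simp add: space_restrict_space)
  note meas = borel_measurable_unit_ball_distribution[OF mu]
  have norm_Q: "norm (quarter_turn *v v) = norm v" for v
    by (simp add: norm_vec_def L2_set_def sum_2 quarter_turn_apply add.commute)
  have "(\<lambda>v. quarter_turn *v v) \<in> borel_measurable borel"
    by (intro borel_measurable_continuous_onI linear_continuous_on matrix_vector_mul_bounded_linear)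
  then have Q: "(\<lambda>v. quarter_turn *v v) \<in> measurable mu mu"
    unfolding measurable_cong_sets[OF sets_mu sets_mu]
    by (intro measurable_restrict_space2 measurable_restrict_space1)
       (auto simp: space_restrict_space norm_Q)
  have turn: "(\<integral>v. f (quarter_turn *v v) \<partial>mu) = (\<integral>v. f v \<partial>mu)"
    if "f \<in> borel_measurable borel" for f :: "real ^ 2 \<Rightarrow> real"
  proof -
    have "(\<integral>v. f v \<partial>mu) = (\<integral>v. f v \<partial>distr mu mu (\<lambda>v. quarter_turn *v v))"
      using rot rotation_matrix_quarter_turn by (simp add: rotation_invariant_def)
    also have "\<dots> = (\<integral>v. f (quarter_turn *v v) \<partial>mu)"
      by (rule integral_distr[OF Q meas[OF that]])
    finally show ?thesis by simp
  qed
  have "(\<integral>v. v $ 1 \<partial>mu) = - (\<integral>v. v $ 2 \<partial>mu)" "(\<integral>v. v $ 2 \<partial>mu) = (\<integral>v. v $ 1 \<partial>mu)"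
    using turn[of "\<lambda>v. v $ 1"] turn[of "\<lambda>v. v $ 2"] by (simp_all add: quarter_turn_apply)
  then show "(\<integral>v. v $ j \<partial>mu) = 0"
    using exhaust_2[of j] by auto
  have int: "integrable mu (\<lambda>v. (v $ i)\<^sup>2)" for i
  proof (rule integrable_const_bound[where B = 1])
    show "AE v in mu. norm ((v $ i)\<^sup>2) \<le> 1"
    proof (rule AE_I2)
      fix v assume "v \<in> space mu"
      then have "\<bar>v $ i\<bar> \<le> 1" using component_le_norm_cart[of v i] by (simp add: space_mu)
      then show "norm ((v $ i)\<^sup>2) \<le> 1" by (simp add: abs_square_le_1)
    qed
  qed (intro meas, measurable)
  have eq: "(\<integral>v. (v $ 2)\<^sup>2 \<partial>mu) = (\<integral>v. (v $ 1)\<^sup>2 \<partial>mu)"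
    using turn[of "\<lambda>v. (v $ 2)\<^sup>2"] by (simp add: quarter_turn_apply)
  have "(\<integral>v. (norm v)\<^sup>2 \<partial>mu) = (\<integral>v. (v $ 1)\<^sup>2 + (v $ 2)\<^sup>2 \<partial>mu)"
    by (simp add: norm_vec2_sq)
  also have "\<dots> = (\<integral>v. (v $ 1)\<^sup>2 \<partial>mu) + (\<integral>v. (v $ 2)\<^sup>2 \<partial>mu)"
    using int by (intro Bochner_Integration.integral_add)
  finally show "(\<integral>v. (v $ j)\<^sup>2 \<partial>mu) = (\<integral>v. (norm v)\<^sup>2 \<partial>mu) / 2"
    using eq exhaust_2[of j] by auto
qed

lemma measurable_sbm_exact_recovery:
  fixes mu :: "(real ^ 'm) measure"
  assumes id: "(\<lambda>v. v) \<in> borel_measurable mu"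
  shows "{\<omega>\<in>space (sbm_space mu k n). exact_recovery k (sbm_cluster c n \<omega>)} \<in> sets (sbm_space mu k n)"
proof -
  define I where "I = {1..k} \<times> {1..n}"
  \<comment> \<open>Measurability is required for every index, but only those in \<open>I\<close>
    are coordinates of the product space; 0 is an arbitrary filler.\<close>
  define X where "X \<omega> il = (if il \<in> I then c (fst il) + \<omega> il else 0)" for \<omega> :: "nat \<times> nat \<Rightarrow> real ^ 'm" and il
  have "(\<lambda>\<omega>. X \<omega> il) \<in> borel_measurable (sbm_space mu k n)" for il
  proof (cases "il \<in> I")
    case True
    then have "(\<lambda>\<omega>. \<omega> il) \<in> measurable (sbm_space mu k n) mu"
      unfolding sbm_space_def I_def by (rule measurable_component_singleton)
    then have "(\<lambda>\<omega>. \<omega> il) \<in> borel_measurable (sbm_space mu k n)"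
      using id by (rule measurable_compose)
    with True show ?thesis unfolding X_def by simp
  qed (simp add: X_def)
  moreover have "exact_recovery k (sbm_cluster c n \<omega>) \<longleftrightarrow> exact_recovery k (\<lambda>i. X \<omega> ` ({i} \<times> {1..n}))" for \<omega>
  proof -
    have C: "sbm_cluster c n \<omega> i = X \<omega> ` ({i} \<times> {1..n})" if "i \<in> {1..k}" for i
      using that by (force simp: sbm_cluster_def X_def I_def image_iff)
    show ?thesis unfolding exact_recovery_def Let_def by (simp add: C cong: SUP_cong_simp)
  qed
  ultimately show ?thesis
    using measurable_exact_recovery[of "\<lambda>i. {i} \<times> {1..n}" k X "sbm_space mu k n"] by simp
qed

text \<open>The law of large numbers is applied to the two coordinates, their squares and the
  indicators of three small discs; on the resulting event, and for distinct sample points, the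
  deterministic argument applies.\<close>

lemma line_sbm_fails_whp:
  fixes mu :: "(real ^ 2) measure"
  assumes mu: "unit_ball_distribution mu" and rot: "rotation_invariant mu"
    and no_atoms: "\<And>x. emeasure mu {x} = 0"
    and charged: "\<And>U. open U \<Longrightarrow> U \<inter> ball 0 1 \<noteq> {} \<Longrightarrow> measure mu (U \<inter> cball 0 1) > 0"
    and moment: "(\<integral>v. (norm v)\<^sup>2 \<partial>mu) \<ge> 0.999"
  shows "with_high_probability (sbm_space mu 7) (\<lambda>n \<omega>. \<not> exact_recovery 7 (sbm_cluster line_center n \<omega>))"
  unfolding with_high_probability_def
proof (intro allI impI)
  fix \<delta> :: real assume "0 < \<delta> \<and> \<delta> < 1"
  then have \<delta>: "\<delta> > 0" by simp
  have prob: "prob_space mu" using mu by (simp add: unit_ball_distribution_def)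
  then interpret mu: prob_space mu .
  have sets_mu: "sets mu = sets (restrict_space borel (cball 0 1))"
    using mu by (simp add: unit_ball_distribution_def)
  have space_mu: "space mu = cball 0 1"
    using sets_eq_imp_space_eq[OF sets_mu] by (simp add: space_restrict_space)
  note meas = borel_measurable_unit_ball_distribution[OF mu]
  have in_sets: "A \<inter> cball 0 1 \<in> sets mu" if "A \<in> sets borel" for A
    using that by (auto simp: sets_mu sets_restrict_space)
  define hit where "hit t = (\<lambda>v. indicator (cball (t *\<^sub>R e1) (1/1000)) v :: real)" for t
  define p where "p t = (\<integral>v. hit t v \<partial>mu)" for t
  have p_pos: "p t > 0" if "t \<in> {- 1, 0, 1}" for t
  proof -
    \<comment> \<open>The contact points lie on the boundary circle. The factor 0.9995 moves them
      inside the open disc by less than the tolerance.\<close>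
    have "dist (t *\<^sub>R e1) ((0.9995 * t) *\<^sub>R e1) = \<bar>t - 0.9995 * t\<bar>"
      unfolding dist_norm scaleR_diff_left[symmetric] by simp
    then have "(0.9995 * t) *\<^sub>R e1 \<in> ball (t *\<^sub>R e1) (1/1000) \<inter> ball 0 1"
      using that unfolding Int_iff mem_ball by auto
    then have "ball (t *\<^sub>R e1) (1/1000) \<inter> ball 0 1 \<noteq> {}" by blast
    then have "0 < mu.prob (ball (t *\<^sub>R e1) (1/1000) \<inter> cball 0 1)"
      by (rule charged[OF open_ball])
    also have "\<dots> \<le> mu.prob (cball (t *\<^sub>R e1) (1/1000) \<inter> cball 0 1)"
      using ball_subset_cball by (intro mu.finite_measure_mono in_sets) auto
    also have "\<dots> = p t"
    proof -
      have "p t = (\<integral>v. indicator (cball (t *\<^sub>R e1) (1/1000) \<inter> cball 0 1) v \<partial>mu)"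
        unfolding p_def hit_def by (intro Bochner_Integration.integral_cong) (auto simp: space_mu indicator_def)
      then show ?thesis using in_sets by simp
    qed
    finally show ?thesis .
  qed
  \<comment> \<open>The bound 1/1000 serves the moments. Being at most half of each hit probability,
    \<epsilon> also keeps every hit count positive.\<close>
  define \<epsilon> where "\<epsilon> = Min (insert (1/1000) ((\<lambda>t. p t / 2) ` {- 1, 0, 1}))"
  have \<epsilon>: "\<epsilon> > 0" "\<epsilon> \<le> 1/1000" and \<epsilon>p: "\<And>t. t \<in> {- 1, 0, 1} \<Longrightarrow> \<epsilon> \<le> p t / 2"
    using p_pos by (auto simp: \<epsilon>_def)
  define \<Phi> :: "(real ^ 2 \<Rightarrow> real) set" where
    "\<Phi> = range (\<lambda>j v. v $ j) \<union> range (\<lambda>j v. (v $ j)\<^sup>2) \<union> hit ` {- 1, 0, 1}"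
  have "finite \<Phi>" by (simp add: \<Phi>_def)
  moreover have "\<phi> \<in> borel_measurable mu" if "\<phi> \<in> \<Phi>" for \<phi>
    using that by (intro meas) (auto simp: \<Phi>_def hit_def intro!: borel_measurable_indicator)
  moreover have "\<bar>\<phi> v\<bar> \<le> 1" if "\<phi> \<in> \<Phi>" "v \<in> space mu" for \<phi> v
  proof -
    have "\<bar>v $ j\<bar> \<le> 1" for j
      using that(2) component_le_norm_cart[of v j] by (simp add: space_mu)
    then show ?thesis
      using that(1) by (auto simp: \<Phi>_def hit_def indicator_def abs_square_le_1)
  qed
  ultimately obtain N where "N > 0" and N: "\<And>n. n > N \<Longrightarrow>
      {\<omega>\<in>space (sbm_space mu 7 n). \<forall>i\<in>{1..7}. \<forall>\<phi>\<in>\<Phi>.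
        \<bar>(\<Sum>l\<in>{1..n}. \<phi> (\<omega> (i, l))) - n * (\<integral>v. \<phi> v \<partial>mu)\<bar> < \<epsilon> * n} \<in> sets (sbm_space mu 7 n) \<and>
      measure (sbm_space mu 7 n) {\<omega>\<in>space (sbm_space mu 7 n). \<forall>i\<in>{1..7}. \<forall>\<phi>\<in>\<Phi>.
        \<bar>(\<Sum>l\<in>{1..n}. \<phi> (\<omega> (i, l))) - n * (\<integral>v. \<phi> v \<partial>mu)\<bar> < \<epsilon> * n} > 1 - \<delta>"
    using sbm_uniform_law_of_large_numbers[OF prob, of \<Phi> \<epsilon> \<delta> 7] \<epsilon>(1) \<delta> by blast
  show "\<exists>N>0. \<forall>n>N. measure (sbm_space mu 7 n)
      {\<omega>\<in>space (sbm_space mu 7 n). \<not> exact_recovery 7 (sbm_cluster line_center n \<omega>)} > 1 - \<delta>"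
  proof (intro exI[of _ N] conjI allI impI)
    fix n assume "n > N"
    define M where "M = sbm_space mu 7 n"
    interpret M: prob_space M unfolding M_def by (rule prob_space_sbm_space[OF prob])
    define G where "G = {\<omega>\<in>space M. \<forall>i\<in>{1..7}. \<forall>\<phi>\<in>\<Phi>.
        \<bar>(\<Sum>l\<in>{1..n}. \<phi> (\<omega> (i, l))) - n * (\<integral>v. \<phi> v \<partial>mu)\<bar> < \<epsilon> * n}"
    let ?F = "{\<omega>\<in>space M. \<not> exact_recovery 7 (sbm_cluster line_center n \<omega>)}"
    have F: "?F \<in> sets M"
      unfolding M_def by (intro sets.sets_Collect_neg measurable_sbm_exact_recovery meas) simp
    have fails: "\<omega> \<in> ?F" if \<omega>: "\<omega> \<in> G"
      and inj: "inj_on (\<lambda>(i, l). line_center i + \<omega> (i, l)) ({1..7} \<times> {1..n})" for \<omega>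
    proof -
      have n: "n > 0" using \<open>n > N\<close> by simp
      have space: "\<omega> \<in> space M" using \<omega> by (simp add: G_def)
      have dev: "\<bar>(\<Sum>l\<in>{1..n}. \<phi> (\<omega> (i, l))) - n * (\<integral>v. \<phi> v \<partial>mu)\<bar> < \<epsilon> * n"
        if "i \<in> {1..7}" "\<phi> \<in> \<Phi>" for i \<phi>
        using \<omega> that by (simp add: G_def)
      have \<epsilon>n: "\<epsilon> * n \<le> n / 1000"
        using \<epsilon>(2) mult_right_mono[of \<epsilon> "1/1000" "real n"] by simp
      have "\<not> exact_recovery 7 (sbm_cluster line_center n \<omega>)"
      proof (rule line_not_exact_recovery[OF n _ inj _ _ _ moment])
        fix i l :: nat assume il: "i \<in> {1..7}" "l \<in> {1..n}"
        then have "\<omega> (i, l) \<in> space mu"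
          using space by (auto simp: M_def sbm_space_def space_PiM PiE_iff)
        then show "norm (\<omega> (i, l)) \<le> 1" by (simp add: space_mu)
      next
        fix i :: nat and t :: real assume i: "i \<in> {1..7}" and t: "t \<in> {- 1, 0, 1}"
        have "\<bar>(\<Sum>l\<in>{1..n}. hit t (\<omega> (i, l))) - n * p t\<bar> < \<epsilon> * n"
          unfolding p_def \<Phi>_def by (intro dev[OF i, unfolded \<Phi>_def] UnI2 imageI t)
        moreover have "\<epsilon> * n \<le> n * p t"
          using \<epsilon>p[OF t] p_pos[OF t] n by (subst mult.commute) (intro mult_left_mono, auto)
        ultimately have "(\<Sum>l\<in>{1..n}. hit t (\<omega> (i, l))) \<noteq> 0" by auto
        then obtain l where "l \<in> {1..n}" "hit t (\<omega> (i, l)) \<noteq> 0" by (meson sum.neutral)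
        then show "\<exists>l\<in>{1..n}. norm (\<omega> (i, l) - t *\<^sub>R e1) \<le> 1/1000"
          by (intro bexI[of _ l]) (auto simp: hit_def indicator_def dist_norm norm_minus_commute split: if_splits)
      next
        fix i :: nat and j :: 2 assume i: "i \<in> {1..7}"
        have "(\<lambda>v. v $ j) \<in> \<Phi>" "(\<lambda>v. (v $ j)\<^sup>2) \<in> \<Phi>" by (auto simp: \<Phi>_def)
        note d = this[THEN dev[OF i], unfolded rotation_invariant_moments[OF mu rot]]
        show "\<bar>\<Sum>l\<in>{1..n}. \<omega> (i, l) $ j\<bar> \<le> n / 1000" using d(1) \<epsilon>n by simp
        show "\<bar>(\<Sum>l\<in>{1..n}. (\<omega> (i, l) $ j)\<^sup>2) - n * ((\<integral>v. (norm v)\<^sup>2 \<partial>mu) / 2)\<bar> \<le> n / 1000"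
          using d(2) \<epsilon>n by (meson less_imp_le order_trans)
      qed
      then show ?thesis using space by simp
    qed
    have "AE \<omega> in M. inj_on (\<lambda>(i, l). line_center i + \<omega> (i, l)) ({1..7} \<times> {1..n})"
      unfolding M_def
    proof (rule AE_sbm_points_distinct[OF prob meas no_atoms])
      show "{x} \<in> sets mu" if "x \<in> space mu" for x
        using in_sets[of "{x}"] that by (simp add: space_mu insert_absorb)
    qed simp
    \<comment> \<open>Distinctness holds only almost surely, so the good event lies in the failure
      event up to a null set. Monotonicity then relies on measurability of the failure
      event.\<close>
    then have "AE \<omega> in M. \<omega> \<in> G \<longrightarrow> \<omega> \<in> ?F"
      by eventually_elim (use fails in blast)
    then have "M.prob G \<le> M.prob ?F" using F by (rule M.finite_measure_mono_AE)
    moreover have "M.prob G > 1 - \<delta>" using N[OF \<open>n > N\<close>] by (simp add: G_def M_def)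
    ultimately show "measure (sbm_space mu 7 n)
        {\<omega>\<in>space (sbm_space mu 7 n). \<not> exact_recovery 7 (sbm_cluster line_center n \<omega>)} > 1 - \<delta>"
      by (simp add: M_def)
  qed (rule \<open>N > 0\<close>)
qed

theorem mainTheorem9:
  shows "\<exists>(c :: nat \<Rightarrow> real ^ 2) (mu :: (real ^ 2) measure).
    Min {dist (c i) (c j) |i j. i \<in> {1..7} \<and> j \<in> {1..7} \<and> i \<noteq> j} = 2 + 0.2 \<and>
    unit_ball_distribution mu \<and>
    has_continuous_density mu \<and>
    rotation_invariant mu \<and>
    charges_nbhds_of_0 mu \<and>
    with_high_probability (sbm_space mu 7)
      (\<lambda>n \<omega>. \<not> exact_recovery 7 (sbm_cluster c n \<omega>))"
proof -
  obtain K where K: "(\<integral>v. (norm v)\<^sup>2 \<partial>radial_power_measure K :: (real ^ 2) measure) > 0.999"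
    using radial_power_second_moment[of "0.999"] by auto
  have no_atoms: "emeasure (radial_power_measure K) {x :: real ^ 2} = 0" for x
  proof (cases "x \<in> cball 0 1")
    case False
    then have "{x} \<notin> sets (radial_power_measure K)"
      using sets.sets_into_space[of "{x}" "radial_power_measure K"] by (auto simp: space_radial_power)
    then show ?thesis by (rule emeasure_notin_sets)
  qed (rule radial_power_no_atoms)
  have "with_high_probability (sbm_space (radial_power_measure K) 7)
      (\<lambda>n \<omega>. \<not> exact_recovery 7 (sbm_cluster line_center n \<omega>))"
    using K no_atoms
    by (intro line_sbm_fails_whp unit_ball_distribution_radial_power rotation_invariant_radial_power
        radial_power_open_pos) auto
  then show ?thesis
    using Min_dist_line_center unit_ball_distribution_radial_power has_continuous_density_radial_power
      rotation_invariant_radial_power charges_nbhds_radial_power by blast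
qed

end
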